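(* Let $x_{0}\ge 1$. Then the limit $$\gamma(x_{0})=\lim_{\epsilon\to 0^{+}}\frac{\ln \Delta^{x_{0}}(\epsilon)}{\ln\epsilon}$$ exists, and $$\gamma(x_{0})=\frac{2}{\pi}\arcsin\left(\frac{1}{x_{0}}\right).$$
   Context: A function $f:(0,\infty)\to[0,\infty)$ belongs to the class CM (completely monotone functions) if $f(x)=\int_{0}^{\infty}e^{-xt}\,d\sigma(t)$ for a positive Borel-regular measure $\sigma$ on $[0,\infty)$ such that $f(x)<\infty$ for all $x>0$. Let $\|\cdot\|_{2}$ denote the $L^{2}(0,1)$ norm and $\mathfrak{C}_{2}=\{f\in\mathrm{CM}:\|f\|_{2}<+\infty\}$. For $f,g\in\mathfrak{C}_{2}$, not both zero, let $$\Delta[f,g](x)=\frac{f(x)-g(x)}{\|f\|_{2}+\|g\|_{2}}.$$ For $x_{0}\ge 1$ and $\epsilon>0$ let $$\Delta^{x_{0}}(\epsilon)=\max\{|\Delta[f,g](x_{0})|:\ f,g\in\mathfrak{C}_{2},\ \|\Delta[f,g]\|_{2}\le\epsilon\}.$$ *)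

theory Defs
  imports "HOL-Analysis.Analysis"
begin

text \<open>
  Functions on \<open>(0,\<infinity>)\<close> are total functions on the reals whose values outside \<open>(0,\<infinity>)\<close> are
  irrelevant: nothing below depends on them.

  Equating the nonnegative integral with \<open>ennreal (f x)\<close> includes its finiteness. A Borel-regular
  measure is determined by its restriction to the Borel sets; conversely, finiteness of these
  integrals makes a Borel measure finite on bounded sets, hence regular, so regularity is
  not a separate condition.
\<close>

definition CM :: "(real \<Rightarrow> real) set" where
  "CM = {f. \<exists>\<sigma> :: real measure. sets \<sigma> = sets (restrict_space borel {0..}) \<and>
            (\<forall>x>0. 0 \<le> f x \<and> (\<integral>\<^sup>+ t. ennreal (exp (- (x * t))) \<partial>\<sigma>) = ennreal (f x))}"

definition l2norm :: "(real \<Rightarrow> real) \<Rightarrow> real" where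
  "l2norm f = sqrt (LINT x:{0<..<1}|lborel. (f x)\<^sup>2)"

text \<open>
  Members of \<open>CM\<close> are continuous on \<open>(0,\<infinity>)\<close>, so integrability of the square over \<open>(0,1)\<close> says
  exactly that the \<open>L\<^sup>2\<close> norm is finite.
\<close>

definition C2 :: "(real \<Rightarrow> real) set" where
  "C2 = {f \<in> CM. set_integrable lborel {0<..<1} (\<lambda>x. (f x)\<^sup>2)}"

definition Delta :: "(real \<Rightarrow> real) \<Rightarrow> (real \<Rightarrow> real) \<Rightarrow> real \<Rightarrow> real" where
  "Delta f g x = (f x - g x) / (l2norm f + l2norm g)"

text \<open>
  The maximum is rendered by \<^const>\<open>Greatest\<close>, not by a supremum, so any statement about its
  value requires that the maximum is attained.
\<close>

definition Delta_max :: "real \<Rightarrow> real \<Rightarrow> real" where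
  "Delta_max x0 \<epsilon> =
     (GREATEST d. \<exists>f\<in>C2. \<exists>g\<in>C2. \<not> (\<forall>x>0. f x = 0 \<and> g x = 0) \<and>
                    l2norm (Delta f g) \<le> \<epsilon> \<and> d = \<bar>Delta f g x0\<bar>)"

end

theory Submission
  imports Defs "HOL-Complex_Analysis.Complex_Analysis" "HOL-Probability.Probability"
begin

text \<open>
  A member of \<^const>\<open>CM\<close> extends holomorphically to the right half-plane, so the question is
  how well a holomorphic function there can be recovered at \<open>x0\<close> from its size on \<open>(0,1)\<close>.
  The exponent is the harmonic measure of the slit \<open>[0,1]\<close> in the slit half-plane, seen from
  \<open>x0\<close>. Since \<open>Arcsin (1/z)\<close> is holomorphic off the slit, has real part \<open>\<pi>/2\<close> on it and \<open>0\<close> on the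
  imaginary axis, this harmonic measure is \<open>2/\<pi> Re (Arcsin (1/z))\<close>.

  Upper bound. The two-constants theorem (\<open>two_constants_slit\<close>) bounds a holomorphic function
  that is \<open>\<epsilon>\<close>-small on a slit by \<open>\<epsilon>\<close> to the power of the harmonic measure. It needs
  pointwise smallness, while the data are only small in \<open>L\<^sup>2\<close>; therefore it is applied to the
  primitive of the difference, which Cauchy-Schwarz makes small, and the difference itself
  is recovered from Cauchy's estimate on a small circle around \<open>x0\<close>. Shrinking the slit to
  \<open>[\<delta>, 1 - \<delta>]\<close> gives uniform bounds and costs an arbitrarily small part of the exponent
  (\<open>Delta_max_upper\<close>).

  Lower bound. With \<open>\<epsilon> = exp (- L)\<close> and \<open>k = 2 L / \<pi>\<close>, the function
  \<open>\<epsilon> cosh (k Arccos (1/z))\<close> is holomorphic in the right half-plane, across the slit as well, because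
  \<open>cosh\<close> is even. On the slit it equals \<open>\<epsilon>\<close> times a cosine, in the half-plane it is bounded by \<open>1\<close>,
  and at \<open>x0\<close> it is at least half of \<open>\<epsilon>\<close> to the power \<open>2/\<pi> arcsin (1/x0)\<close>. To split it into
  a difference of completely monotone functions without large cancellation, it is expanded in
  powers of \<open>1 / (z + \<beta>)\<close>: each such power is completely monotone, and for large \<open>\<beta>\<close> the
  function is almost bounded by \<open>1\<close> on the whole region of convergence, so that the coefficients
  are under control after a small shift of the variable (\<open>feasible_lower_bound\<close>).

  The maximum exists by compactness: pointwise bounded sequences in \<^const>\<open>CM\<close> have pointwise
  convergent subsequences with limits in \<^const>\<open>CM\<close> (\<open>CM_compactness\<close>, from Helly's theorem). Norms can drop
  in the limit, but adding one constant to both functions restores the normalisation and leaves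
  their difference alone (\<open>Delta_max_attained\<close>).
\<close>

section \<open>The inverse sine and cosine of a complex number\<close>

text \<open>
  \<open>s = \<i> w + csqrt (1 - w\<^sup>2)\<close>, whose argument is \<open>Re (Arcsin w)\<close>, satisfies \<open>s + 1/s = 2 csqrt (1 - w\<^sup>2)\<close>.
  The principal square root has nonnegative real part, and \<open>Re s\<close>, \<open>Re (1/s)\<close> have the same sign;
  hence \<open>s\<close> lies in the closed right half-plane.
\<close>

lemma Re_Arcsin_le_pi_half: "\<bar>Re (Arcsin w)\<bar> \<le> pi / 2"
proof -
  define r where "r = csqrt (1 - w\<^sup>2)"
  define s where "s = \<i> * w + r"
  have s0: "s \<noteq> 0"
    unfolding s_def r_def by (rule Arcsin_body_lemma)
  have "s * (r - \<i> * w) = r\<^sup>2 + w\<^sup>2"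
    by (simp add: s_def algebra_simps power2_eq_square)
  also have "\<dots> = 1" by (simp add: r_def)
  finally have "1 / s = r - \<i> * w" using s0 by (simp add: field_simps)
  then have "s + 1 / s = r + r" by (simp add: s_def)
  then have "Re s + Re (1 / s) = Re r + Re r" by (metis plus_complex.simps(1))
  moreover have "Re (1 / s) = Re s / (cmod s)\<^sup>2"
    by (simp add: Re_divide cmod_power2)
  ultimately have "Re s * (1 + 1 / (cmod s)\<^sup>2) = 2 * Re r"
    by (simp add: algebra_simps)
  moreover have "Re r \<ge> 0" unfolding r_def using csqrt_principal[of "1 - w\<^sup>2"] by (metis less_eq_real_def)
  moreover have "1 + 1 / (cmod s)\<^sup>2 > 0"
    by (simp add: add_pos_nonneg)
  ultimately have "Re s \<ge> 0"
    using mult_neg_pos[of "Re s" "1 + 1 / (cmod s)\<^sup>2"] by linarith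
  then have "\<bar>Im (Ln s)\<bar> \<le> pi / 2"
    using Re_Ln_pos_le[OF s0] by simp
  then show ?thesis by (simp add: Re_Arcsin s_def r_def)
qed

lemma Re_sin_complex: "Re (sin z) = sin (Re z) * cosh (Im z)"
  by (simp add: Re_sin cosh_def field_simps)

lemma Re_cos_complex: "Re (cos z) = cos (Re z) * cosh (Im z)"
  by (simp add: Re_cos cosh_def field_simps)

text \<open>
  Applied to \<open>w = a / z\<close> this says that the harmonic measure of the slit vanishes on the
  imaginary axis.
\<close>

lemma Re_Arcsin_eq_0:
  assumes "Re w = 0" shows "Re (Arcsin w) = 0"
proof -
  have "sin (Re (Arcsin w)) * cosh (Im (Arcsin w)) = 0"
    unfolding Re_sin_complex[symmetric] using assms by simp
  then have "sin (Re (Arcsin w)) = 0" by simp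
  moreover have "arcsin (sin (Re (Arcsin w))) = Re (Arcsin w)"
    using Re_Arcsin_le_pi_half[of w] by (intro arcsin_sin) auto
  ultimately show ?thesis by simp
qed

text \<open>
  The argument of \<open>Re_Arcsin_le_pi_half\<close> with \<open>s = w + \<i> csqrt (1 - w\<^sup>2)\<close>, for which \<open>s - 1/s\<close> is \<open>2 \<i>\<close> times
  the root: here \<open>s\<close> lies in the closed upper half-plane.
\<close>

lemma Re_Arccos_range: "0 \<le> Re (Arccos w)" "Re (Arccos w) \<le> pi"
proof -
  define r where "r = csqrt (1 - w\<^sup>2)"
  define s where "s = w + \<i> * r"
  have s0: "s \<noteq> 0"
    unfolding s_def r_def by (rule Arccos_body_lemma)
  have "s * (w - \<i> * r) = r\<^sup>2 + w\<^sup>2"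
    by (simp add: s_def algebra_simps power2_eq_square)
  also have "\<dots> = 1" by (simp add: r_def)
  finally have "1 / s = w - \<i> * r" using s0 by (simp add: field_simps)
  then have "Im (1 / s) = Im w - Re r" by simp
  moreover have "Im s = Im w + Re r" by (simp add: s_def)
  ultimately have "Im s - Im (1 / s) = 2 * Re r" by simp
  moreover have "Im (1 / s) = - Im s / (cmod s)\<^sup>2"
    by (simp add: Im_divide cmod_power2)
  ultimately have "Im s * (1 + 1 / (cmod s)\<^sup>2) = 2 * Re r"
    by (simp add: algebra_simps)
  moreover have "Re r \<ge> 0" unfolding r_def using csqrt_principal[of "1 - w\<^sup>2"] by (metis less_eq_real_def)
  moreover have "1 + 1 / (cmod s)\<^sup>2 > 0"
    by (simp add: add_pos_nonneg)
  ultimately have "Im s \<ge> 0"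
    using mult_neg_pos[of "Im s" "1 + 1 / (cmod s)\<^sup>2"] by linarith
  then have "0 \<le> Im (Ln s)"
    using Im_Ln_pos_le[OF s0] by simp
  then show "0 \<le> Re (Arccos w)" by (simp add: Re_Arccos s_def r_def)
  show "Re (Arccos w) \<le> pi"
    using Re_Arccos_bounds by blast
qed

text \<open>
  For \<open>z = Arccos w\<close> the identity \<open>Re w = cos (Re z) cosh (Im z)\<close> and \<open>cosh \<ge> 1\<close> show that a lower bound
  \<open>- a\<close> of \<open>Re w\<close> is also one of \<open>cos (Re z)\<close>, as soon as that cosine is negative.
\<close>

lemma Re_Arccos_le:
  assumes "Re w \<ge> - a" "0 \<le> a" "a \<le> 1"
  shows "Re (Arccos w) \<le> pi / 2 + arcsin a"
proof (rule ccontr)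
  let ?x = "Re (Arccos w)"
  assume "\<not> ?thesis"
  then have gt: "?x > pi / 2 + arcsin a" by simp
  have as: "0 \<le> arcsin a" "arcsin a \<le> pi/2" "sin (arcsin a) = a"
    using assms arcsin_le_arcsin[of 0 a] arcsin_bounded[of a] by auto
  have "cos ?x < cos (pi / 2 + arcsin a)"
    using gt as Re_Arccos_range[of w] by (intro cos_monotone_0_pi) auto
  also have "\<dots> = - a" using as by (simp add: cos_add)
  finally have *: "cos ?x < - a" .
  have "Re w = cos ?x * cosh (Im (Arccos w))"
    by (simp flip: Re_cos_complex)
  also have "\<dots> \<le> cos ?x * 1"
    using * assms cosh_real_ge_1 by (intro mult_left_mono_neg) auto
  finally show False using * assms by simp
qed

section \<open>A two-constants theorem for the slit half-plane\<close>

text \<open>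
  \<open>u z = 2/\<pi> Re (Arcsin (a/z))\<close> is the harmonic measure of the slit \<open>[0,a]\<close>, so \<open>\<epsilon>\<close> to the power
  \<open>- u\<close> is the modulus of a holomorphic function, and its product \<open>\<Phi>\<close> with \<open>H\<close> is bounded by \<open>M\<close>
  at the boundary: on the slit because \<open>u \<le> 1\<close>, elsewhere on the imaginary axis because \<open>u = 0\<close>. As
  \<open>Arcsin (a/z)\<close> jumps across the slit, the maximum principle is used in the form that
  a maximising sequence cannot approach the boundary or infinity. The maximum would thus be attained on
  a nonempty compact subset \<open>K\<close> of the open domain, contradicting the local maximum principle at the
  rightmost point of \<open>K\<close>.
\<close>

lemma two_constants_slit:
  fixes H :: "complex \<Rightarrow> complex" and z :: complex and a M \<epsilon> :: real
  assumes a: "a > 0" and eps: "0 < \<epsilon>" "\<epsilon> < 1"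
    and cont: "continuous_on {z. Re z \<ge> 0} H"
    and hol: "H holomorphic_on {z. Re z > 0}"
    and bd: "\<And>z. Re z \<ge> 0 \<Longrightarrow> cmod (H z) \<le> M"
    and slit: "\<And>x. 0 \<le> x \<Longrightarrow> x \<le> a \<Longrightarrow> cmod (H (of_real x)) \<le> M * \<epsilon>"
    and inf: "(H \<longlongrightarrow> 0) (inf at_infinity (principal {z. Re z \<ge> 0}))"
    and z: "Re z > 0" "z \<notin> of_real ` {0..a}"
  shows "cmod (H z) \<le> M * \<epsilon> powr (2 / pi * Re (Arcsin (of_real a / z)))"
proof -
  define D where "D = {z. Re z > 0} - of_real ` {0..a}"
  define L where "L = - ln \<epsilon>"
  have L: "L > 0" using eps by (simp add: L_def)
  define u where "u = (\<lambda>z. 2 / pi * Re (Arcsin (of_real a / z)))"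
  define \<Phi> where "\<Phi> = (\<lambda>z. H z * exp (L * (2 / pi) * Arcsin (of_real a / z)))"
  have oD: "open D"
    unfolding D_def by (intro open_Diff open_halfspace_Re_gt compact_imp_closed compact_continuous_image continuous_intros) auto
  have arg: "Im (of_real a / z) = 0 \<Longrightarrow> \<bar>Re (of_real a / z)\<bar> < 1" if "Re z \<ge> 0" "z \<noteq> 0" "z \<notin> of_real ` {0..a}" for z
  proof -
    assume im: "Im (of_real a / z) = 0"
    then have "Im z = 0" using a that by (auto simp: Im_divide complex_eq_iff)
    then have x: "z = of_real (Re z)" by (simp add: complex_eq_iff)
    have "\<not> Re z \<le> a"
    proof
      assume "Re z \<le> a"
      then have "z \<in> of_real ` {0..a}" using x that(1) by (intro image_eqI[of _ _ "Re z"]) auto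
      then show False using that by simp
    qed
    then have "Re z > a" by simp
    moreover have "Re (of_real a / z) = a / Re z"
      using x by (metis Re_complex_of_real of_real_divide)
    ultimately show ?thesis using a by simp
  qed
  have contA: "isCont (\<lambda>z. Arcsin (of_real a / z)) z" if "Re z \<ge> 0" "z \<noteq> 0" "z \<notin> of_real ` {0..a}" for z
    using arg[OF that] that by (intro continuous_intros isCont_o2[OF _ isCont_Arcsin]) auto
  have Phi_hol: "\<Phi> holomorphic_on D"
  proof -
    have "(\<lambda>z. Arcsin (of_real a / z)) holomorphic_on D"
    proof -
      have Dsub: "Re w \<ge> 0" "w \<noteq> 0" "w \<notin> of_real ` {0..a}" if "w \<in> D" for w
        using that by (auto simp: D_def)
      have "Arcsin holomorphic_on (\<lambda>z. of_real a / z) ` D"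
        by (rule holomorphic_on_Arcsin, elim imageE, simp only:, rule arg[OF Dsub])
      moreover have "(\<lambda>z. of_real a / z) holomorphic_on D"
        by (intro holomorphic_intros) (auto simp: D_def)
      ultimately show ?thesis
        using holomorphic_on_compose[of "\<lambda>z. of_real a / z" D Arcsin] by (simp add: o_def)
    qed
    then show ?thesis unfolding \<Phi>_def
      by (intro holomorphic_intros holomorphic_on_subset[OF hol]) (auto simp: D_def)
  qed
  have normPhi: "cmod (\<Phi> z) = cmod (H z) * exp (L * u z)" for z
    by (simp add: \<Phi>_def norm_mult u_def)
  have u_le: "u z \<le> 1" for z
    using Re_Arcsin_le_pi_half[of "of_real a / z"] pi_gt_zero by (auto simp: u_def field_simps abs_le_iff)
  have M0: "M \<ge> 0" using bd[of 0] by (smt (verit) norm_ge_zero zero_complex.simps(1) order_refl)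
  have expL: "exp L = 1 / \<epsilon>" using eps by (simp add: L_def exp_minus field_simps)
  have main: "cmod (\<Phi> z) \<le> M" if zD: "z \<in> D" for z
  proof (rule ccontr)
    assume "\<not> ?thesis"
    then have big: "cmod (\<Phi> z) > M" by simp
    define S where "S = (\<lambda>z. cmod (\<Phi> z)) ` D"
    define s where "s = Sup S"
    have bddS: "bdd_above S"
    proof -
      have "cmod (\<Phi> w) \<le> M * exp L" if "w \<in> D" for w
        unfolding normPhi using that bd[of w] u_le[of w] L M0
        by (intro mult_mono) (auto simp: D_def)
      then show ?thesis by (auto simp: S_def bdd_above_def)
    qed
    have zS: "cmod (\<Phi> z) \<in> S" using zD by (auto simp: S_def)
    have s_gt: "s > M"
      using big cSup_upper[OF zS bddS] by (simp add: s_def)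
    have "S \<noteq> {}" using zS by blast
    have "\<exists>w\<in>D. cmod (\<Phi> w) > s - 1 / Suc n" for n
    proof -
      have "s - 1 / Suc n < Sup S" by (simp add: s_def)
      then obtain y where "y \<in> S" "y > s - 1 / Suc n"
        using less_cSup_iff[OF \<open>S \<noteq> {}\<close> bddS] by auto
      then show ?thesis by (auto simp: S_def)
    qed
    then obtain w where wD: "\<And>n. w n \<in> D" and ws: "\<And>n. cmod (\<Phi> (w n)) > s - 1 / Suc n"
      by metis
    have w_up: "cmod (\<Phi> (w n)) \<le> s" for n
      unfolding s_def by (rule cSup_upper[OF _ bddS]) (auto simp: S_def wD)
    have lim_s: "(\<lambda>n. cmod (\<Phi> (w n))) \<longlonglongrightarrow> s"
    proof (rule tendsto_sandwich)
      show "(\<lambda>n. s - 1 / Suc n) \<longlonglongrightarrow> s"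
        using LIMSEQ_inverse_real_of_nat_add_minus[of s] by (simp add: inverse_eq_divide)
      show "(\<lambda>n. s) \<longlonglongrightarrow> s" by simp
    qed (use ws w_up in \<open>auto intro!: always_eventually less_imp_le\<close>)
    \<comment> \<open>\<open>H\<close> vanishes at infinity and the other factor of \<open>\<Phi>\<close> is at most \<open>1 / \<epsilon>\<close>,
      so the sequence stays bounded.\<close>
    have "\<exists>R. \<forall>w\<in>D. cmod w \<ge> R \<longrightarrow> cmod (\<Phi> w) \<le> s / 2"
    proof -
      have s0: "s > 0" using s_gt M0 by simp
      have "eventually (\<lambda>z. dist (H z) 0 < s * \<epsilon> / 2) (inf at_infinity (principal {z. Re z \<ge> 0}))"
        using inf s0 eps by (intro tendstoD) auto
      then obtain R where R: "\<And>w. cmod w \<ge> R \<Longrightarrow> Re w \<ge> 0 \<Longrightarrow> cmod (H w) < s * \<epsilon> / 2"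
        by (auto simp: eventually_inf_principal eventually_at_infinity)
      have "cmod (\<Phi> w) \<le> s / 2" if "w \<in> D" "cmod w \<ge> R" for w
      proof -
        have "cmod (\<Phi> w) \<le> (s * \<epsilon> / 2) * exp L"
          unfolding normPhi using that R[of w] u_le[of w] L s0 eps
          by (intro mult_mono) (auto simp: D_def intro: less_imp_le)
        then show ?thesis using expL eps by simp
      qed
      then show ?thesis by blast
    qed
    then obtain R where R: "\<And>w. w \<in> D \<Longrightarrow> cmod w \<ge> R \<Longrightarrow> cmod (\<Phi> w) \<le> s / 2" by blast
    have s0: "s > 0" using s_gt M0 by simp
    have "eventually (\<lambda>n. cmod (\<Phi> (w n)) > s / 2) sequentially"
      using order_tendstoD(1)[OF lim_s, of "s/2"] s0 by simp
    then obtain N where N: "\<And>n. n \<ge> N \<Longrightarrow> cmod (\<Phi> (w n)) > s / 2"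
      by (auto simp: eventually_sequentially)
    have wR: "cmod (w (n + N)) < R" for n
      using N[of "n + N"] R[OF wD, of "n + N"] by (meson le_add2 not_le)
    have "bounded (range (\<lambda>n. w (n + N)))"
      using wR by (auto simp: bounded_iff intro: less_imp_le)
    then obtain l r where r: "strict_mono (r :: nat \<Rightarrow> nat)" and l: "((\<lambda>n. w (n + N)) \<circ> r) \<longlonglongrightarrow> l"
      using bounded_imp_convergent_subsequence by blast
    define v where "v = (\<lambda>n. w (r n + N))"
    have v: "v \<longlonglongrightarrow> l" using l by (simp add: v_def o_def)
    have vD: "v n \<in> D" for n by (simp add: v_def wD)
    have lim_v: "(\<lambda>n. cmod (\<Phi> (v n))) \<longlonglongrightarrow> s"
    proof -
      have "strict_mono (\<lambda>n. r n + N)" using r by (auto simp: strict_mono_def)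
      from LIMSEQ_subseq_LIMSEQ[OF lim_s this] show ?thesis by (simp add: v_def o_def)
    qed
    have attained: "l \<in> D \<and> cmod (\<Phi> l) = s"
      if v: "v \<longlonglongrightarrow> l" and vD: "\<And>n. v n \<in> D" and lim_v: "(\<lambda>n. cmod (\<Phi> (v n))) \<longlonglongrightarrow> s" for v :: "nat \<Rightarrow> complex" and l
    proof -
      have Rel: "Re l \<ge> 0"
        using tendsto_Re[OF v] vD by (rule_tac LIMSEQ_le_const) (auto simp: D_def less_imp_le)
      have Hv: "(\<lambda>n. H (v n)) \<longlonglongrightarrow> H l"
        using cont v vD Rel by (auto simp: continuous_on_sequentially D_def o_def less_imp_le)
      have "l \<in> D"
      proof (rule ccontr)
        assume "l \<notin> D"
        then consider "l \<in> of_real ` {0..a}" | "Re l = 0" "l \<notin> of_real ` {0..a}"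
          using Rel by (force simp: D_def)
        then have "s \<le> M"
        proof cases
          case 1
          then have "cmod (H l) \<le> M * \<epsilon>" using slit by auto
          moreover have "s \<le> cmod (H l) * exp L"
          proof (rule LIMSEQ_le[OF lim_v])
            show "(\<lambda>n. cmod (H (v n)) * exp L) \<longlonglongrightarrow> cmod (H l) * exp L"
              by (intro tendsto_intros Hv)
            show "\<exists>N. \<forall>n\<ge>N. cmod (\<Phi> (v n)) \<le> cmod (H (v n)) * exp L"
              unfolding normPhi using u_le L by (auto intro!: exI[of _ 0] mult_left_mono)
          qed
          ultimately have "s \<le> M * \<epsilon> * exp L" by (meson exp_ge_zero mult_right_mono order_trans)
          then show ?thesis using expL eps by simp
        next
          case 2
          have l0: "l \<noteq> 0" using 2 a by force
          have "(\<lambda>n. u (v n)) \<longlonglongrightarrow> u l"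
            unfolding u_def
            by (intro tendsto_intros isCont_tendsto_compose[OF contA[OF Rel l0 2(2)] v])
          moreover have "u l = 0"
            using Re_Arcsin_eq_0[of "of_real a / l"] 2 by (simp add: u_def Re_divide)
          ultimately have "(\<lambda>n. cmod (H (v n)) * exp (L * u (v n))) \<longlonglongrightarrow> cmod (H l) * exp (L * 0)"
            by (intro tendsto_intros Hv) simp
          then have "s = cmod (H l)"
            using lim_v by (intro LIMSEQ_unique[OF lim_v]) (simp add: normPhi)
          then show ?thesis using bd Rel by simp
        qed
        then show False using s_gt by simp
      qed
      have Phi_cont: "continuous_on D \<Phi>" using Phi_hol holomorphic_on_imp_continuous_on by blast
      have Kl: "cmod (\<Phi> l) = s"
      proof -
        have "(\<lambda>n. \<Phi> (v n)) \<longlonglongrightarrow> \<Phi> l"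
          using Phi_cont v vD \<open>l \<in> D\<close> by (auto simp: continuous_on_sequentially o_def)
        then show ?thesis using LIMSEQ_unique[OF lim_v] tendsto_norm by blast
      qed
      show ?thesis using \<open>l \<in> D\<close> Kl by blast
    qed
    define K where "K = {w \<in> D. cmod (\<Phi> w) = s}"
    have "l \<in> K" using attained[OF v vD lim_v] by (simp add: K_def)
    have "bounded K"
      unfolding bounded_iff
    proof (intro exI ballI)
      fix w assume "w \<in> K"
      then show "cmod w \<le> R" using R[of w] s0 by (cases "cmod w \<ge> R") (auto simp: K_def)
    qed
    moreover have "closed K"
      unfolding closed_sequential_limits
    proof (intro allI impI, elim conjE)
      fix x m assume x: "\<forall>n. x n \<in> K" "x \<longlonglongrightarrow> m"
      then show "m \<in> K" using attained[of x m] by (simp add: K_def)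
    qed
    ultimately have "compact K" by (simp add: compact_eq_bounded_closed)
    then obtain p where p: "p \<in> K" and pmax: "\<And>w. w \<in> K \<Longrightarrow> Re w \<le> Re p"
      using continuous_attains_sup[of K Re] \<open>l \<in> K\<close> continuous_on_Re[OF continuous_on_id, of K] by auto
    obtain e where e: "e > 0" "ball p e \<subseteq> D"
      using oD p by (auto simp: K_def open_contains_ball)
    have "\<Phi> constant_on ball p e"
    proof (rule maximum_modulus_principle)
      show "\<Phi> holomorphic_on ball p e" using Phi_hol e holomorphic_on_subset by blast
      show "cmod (\<Phi> w) \<le> cmod (\<Phi> p)" if "w \<in> ball p e" for w
      proof -
        have "cmod (\<Phi> w) \<in> S" using that e by (auto simp: S_def)
        then have "cmod (\<Phi> w) \<le> s" unfolding s_def by (rule cSup_upper[OF _ bddS])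
        then show ?thesis using p by (simp add: K_def)
      qed
    qed (use e in auto)
    moreover have q: "p + of_real (e / 2) \<in> ball p e" using e by (simp add: dist_norm)
    ultimately have "\<Phi> (p + of_real (e / 2)) = \<Phi> p"
      using e by (auto simp: constant_on_def)
    then have "p + of_real (e / 2) \<in> K" using q e p by (auto simp: K_def)
    from pmax[OF this] e show False by simp
  qed
  have "z \<in> D" using z by (auto simp: D_def)
  from main[OF this] have "cmod (H z) * exp (L * u z) \<le> M" by (simp add: normPhi)
  then have "cmod (H z) \<le> M * exp (- (L * u z))"
    by (simp add: exp_minus field_simps)
  also have "exp (- (L * u z)) = \<epsilon> powr (u z)"
    using eps by (simp add: powr_def L_def)
  finally show ?thesis by (simp add: u_def)
qed

section \<open>Completely monotone functions\<close>

definition laplace_rep :: "real measure \<Rightarrow> (real \<Rightarrow> real) \<Rightarrow> bool" where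
  "laplace_rep \<sigma> f \<longleftrightarrow> sets \<sigma> = sets (restrict_space borel {0..}) \<and>
     (\<forall>x>0. 0 \<le> f x \<and> (\<integral>\<^sup>+ t. ennreal (exp (- (x * t))) \<partial>\<sigma>) = ennreal (f x))"

lemma CM_iff_laplace_rep: "f \<in> CM \<longleftrightarrow> (\<exists>\<sigma>. laplace_rep \<sigma> f)"
  by (simp add: CM_def laplace_rep_def)

lemma space_half_line:
  assumes "sets \<sigma> = sets (restrict_space borel {0::real..})"
  shows "space \<sigma> = {0..}"
  using sets_eq_imp_space_eq[OF assms] by (simp add: space_restrict_space)

lemma measurable_half_line:
  assumes "sets \<sigma> = sets (restrict_space borel {0::real..})" "g \<in> measurable borel N"
  shows "g \<in> measurable \<sigma> N"
  using measurable_restrict_space1[OF assms(2), of "{0..}"] assms(1)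
  by (simp cong: measurable_cong_sets)

lemma CM_nonneg: "f \<in> CM \<Longrightarrow> x > 0 \<Longrightarrow> 0 \<le> f x"
  by (auto simp: CM_def)

lemma CM_antimono:
  assumes "f \<in> CM" "0 < x" "x \<le> y" shows "f y \<le> f x"
proof -
  obtain \<sigma> where \<sigma>: "laplace_rep \<sigma> f" using assms by (auto simp: CM_iff_laplace_rep)
  have sp: "space \<sigma> = {0..}" using \<sigma> space_half_line by (auto simp: laplace_rep_def)
  have "ennreal (f y) = (\<integral>\<^sup>+ t. ennreal (exp (- (y * t))) \<partial>\<sigma>)"
    using \<sigma> assms by (auto simp: laplace_rep_def)
  also have "\<dots> \<le> (\<integral>\<^sup>+ t. ennreal (exp (- (x * t))) \<partial>\<sigma>)"
    using assms by (intro nn_integral_mono) (auto simp: sp intro!: ennreal_leI mult_right_mono)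
  also have "\<dots> = ennreal (f x)"
    using \<sigma> assms by (auto simp: laplace_rep_def)
  finally show ?thesis using CM_nonneg[OF assms(1,2)] by simp
qed

lemma laplace_rep_integrable:
  assumes \<sigma>: "laplace_rep \<sigma> f" and x: "x > 0"
  shows "integrable \<sigma> (\<lambda>t. exp (- (x * t)))" "(\<integral>t. exp (- (x * t)) \<partial>\<sigma>) = f x"
proof -
  have m: "(\<lambda>t. exp (- (x * t))) \<in> borel_measurable \<sigma>"
    by (rule measurable_half_line) (use \<sigma> in \<open>simp_all add: laplace_rep_def\<close>)
  have *: "(\<integral>\<^sup>+ t. ennreal (exp (- (x * t))) \<partial>\<sigma>) = ennreal (f x)" "0 \<le> f x"
    using \<sigma> x by (auto simp: laplace_rep_def)
  show "integrable \<sigma> (\<lambda>t. exp (- (x * t)))"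
    by (rule integrableI_bounded[OF m]) (simp add: *(1))
  show "(\<integral>t. exp (- (x * t)) \<partial>\<sigma>) = f x"
    by (subst integral_eq_nn_integral[OF m]) (simp_all add: *)
qed

text \<open>
  Differentiation under the integral. Near \<open>z\<close>, with \<open>r = Re z / 2\<close>, the difference quotients of the
  integrand are dominated by \<open>t exp (- r t)\<close>, hence by \<open>2/r exp (- r t / 2)\<close>, which is integrable
  because \<open>f\<close> is finite at \<open>r/2\<close>.
\<close>

lemma CM_holomorphic_extension:
  assumes "f \<in> CM"
  obtains F where "F holomorphic_on {z. Re z > 0}"
    "\<And>x. x > 0 \<Longrightarrow> F (of_real x) = of_real (f x)"
    "\<And>z. Re z > 0 \<Longrightarrow> cmod (F z) \<le> f (Re z)"
proof -
  obtain \<sigma> where \<sigma>: "laplace_rep \<sigma> f" using assms by (auto simp: CM_iff_laplace_rep)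
  have st: "sets \<sigma> = sets (restrict_space borel {0..})" using \<sigma> by (auto simp: laplace_rep_def)
  have sp: "space \<sigma> = {0..}" using st space_half_line by auto
  note int = laplace_rep_integrable(1)[OF \<sigma>] and val = laplace_rep_integrable(2)[OF \<sigma>]
  define F :: "complex \<Rightarrow> complex" where "F = (\<lambda>z. \<integral>t. exp (- (z * of_real t)) \<partial>\<sigma>)"
  have m: "(\<lambda>t. exp (- (z * complex_of_real t))) \<in> borel_measurable \<sigma>" for z
    by (intro measurable_half_line[OF st]) auto
  have intF: "integrable \<sigma> (\<lambda>t. exp (- (z * complex_of_real t)))" if "Re z > 0" for z
    by (rule Bochner_Integration.integrable_bound[OF int[OF that]]) (auto simp: m)
  show ?thesis
  proof
    show "F (of_real x) = of_real (f x)" if "x > 0" for x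
    proof -
      have "F (of_real x) = (\<integral>t. complex_of_real (exp (- (x * t))) \<partial>\<sigma>)"
        unfolding F_def by (intro Bochner_Integration.integral_cong) (auto simp: exp_of_real[symmetric])
      also have "\<dots> = of_real (f x)" using val[OF that] by simp
      finally show ?thesis .
    qed
    show "cmod (F z) \<le> f (Re z)" if "Re z > 0" for z
    proof -
      have "cmod (F z) \<le> (\<integral>t. cmod (exp (- (z * complex_of_real t))) \<partial>\<sigma>)"
        unfolding F_def by (rule integral_norm_bound)
      also have "\<dots> = f (Re z)" using val[OF that] by simp
      finally show ?thesis .
    qed
    show "F holomorphic_on {z. Re z > 0}"
    proof (unfold holomorphic_on_open[OF open_halfspace_Re_gt], intro ballI, simp)
      fix z assume z: "0 < Re z"
      define r where "r = Re z / 2"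
      define S where "S = {w. Re w > r}"
      have r: "r > 0" "z \<in> S" using z by (auto simp: r_def S_def)
      define D where "D = (\<integral>t. - of_real t * exp (- (z * complex_of_real t)) \<partial>\<sigma>)"
      have bound: "cmod ((exp (- (w * of_real t)) - exp (- (z * of_real t))) / (w - z)) \<le> 2 / r * exp (- (r / 2 * t))"
        if "w \<in> S" "w \<noteq> z" "t \<ge> 0" for w t
      proof -
        have "cmod (exp (- (w * of_real t)) - exp (- (z * of_real t))) \<le> (t * exp (- (r * t))) * cmod (w - z)"
        proof (rule field_differentiable_bound[where S = S and f' = "\<lambda>u. - of_real t * exp (- (u * of_real t))"])
          show "convex S" unfolding S_def by (rule convex_halfspace_Re_gt)
          show "((\<lambda>u. exp (- (u * of_real t))) has_field_derivative - of_real t * exp (- (u * of_real t))) (at u within S)" for u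
            by (auto intro!: derivative_eq_intros)
          show "cmod (- of_real t * exp (- (u * of_real t))) \<le> t * exp (- (r * t))" if "u \<in> S" for u
            using that \<open>t \<ge> 0\<close> by (auto simp: norm_mult S_def intro!: mult_left_mono mult_right_mono)
        qed (use that r in auto)
        also have "t * exp (- (r * t)) \<le> 2 / r * exp (- (r / 2 * t))"
        proof -
          have "r / 2 * t \<le> exp (r / 2 * t)" using exp_ge_add_one_self[of "r / 2 * t"] by linarith
          then have "2 / r * (r / 2 * t) \<le> 2 / r * exp (r / 2 * t)" using r by (intro mult_left_mono) auto
          then have "t \<le> 2 / r * exp (r / 2 * t)" using r by simp
          then have "t * exp (- (r * t)) \<le> 2 / r * exp (r / 2 * t) * exp (- (r * t))"
            by (intro mult_right_mono) auto
          also have "\<dots> = 2 / r * exp (r / 2 * t + - (r * t))"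
            by (simp only: exp_add mult.assoc)
          also have "r / 2 * t + - (r * t) = - (r / 2 * t)" by (simp add: field_simps)
          finally show ?thesis .
        qed
        finally have "cmod (exp (- (w * of_real t)) - exp (- (z * of_real t))) \<le> 2 / r * exp (- (r / 2 * t)) * cmod (w - z)"
          by (simp add: mult_right_mono)
        moreover have "cmod (w - z) > 0" using that by simp
        ultimately show ?thesis by (simp only: norm_divide pos_divide_le_eq)
      qed
      have "((\<lambda>w. (F w - F z) / (w - z)) \<longlongrightarrow> D) (at z within S)"
        unfolding tendsto_at_iff_sequentially
      proof (intro allI impI)
        fix X assume X: "\<forall>i. X i \<in> S - {z}" "X \<longlonglongrightarrow> z"
        have Re_pos: "Re (X i) > 0" for i
        proof -
          have "X i \<in> S" using X(1) by blast
          then show ?thesis using r(1) by (simp add: S_def)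
        qed
        have "(\<lambda>i. \<integral>t. (exp (- (X i * of_real t)) - exp (- (z * of_real t))) / (X i - z) \<partial>\<sigma>) \<longlonglongrightarrow> D"
          unfolding D_def
        proof (rule integral_dominated_convergence[where w = "\<lambda>t. 2 / r * exp (- (r / 2 * t))"])
          show "integrable \<sigma> (\<lambda>t. 2 / r * exp (- (r / 2 * t)))"
            by (rule integrable_mult_right, rule int) (use r in simp)
          show "AE t in \<sigma>. (\<lambda>i. (exp (- (X i * of_real t)) - exp (- (z * of_real t))) / (X i - z)) \<longlonglongrightarrow> - of_real t * exp (- (z * of_real t))"
          proof (rule AE_I2)
            fix t
            have "((\<lambda>u. exp (- (u * complex_of_real t))) has_field_derivative - of_real t * exp (- (z * of_real t))) (at z within S)"
              by (auto intro!: derivative_eq_intros)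
            then show "(\<lambda>i. (exp (- (X i * of_real t)) - exp (- (z * of_real t))) / (X i - z)) \<longlonglongrightarrow> - of_real t * exp (- (z * of_real t))"
              using X unfolding has_field_derivative_iff tendsto_at_iff_sequentially o_def by blast
          qed
          show "AE t in \<sigma>. cmod ((exp (- (X i * of_real t)) - exp (- (z * of_real t))) / (X i - z)) \<le> 2 / r * exp (- (r / 2 * t))" for i
            using bound X(1) by (intro AE_I2) (auto simp: sp)
          show "(\<lambda>t. - of_real t * exp (- (z * complex_of_real t))) \<in> borel_measurable \<sigma>"
            by (intro measurable_half_line[OF st]) auto
          show "(\<lambda>t. (exp (- (X i * complex_of_real t)) - exp (- (z * of_real t))) / (X i - z)) \<in> borel_measurable \<sigma>" for i
            by (intro measurable_half_line[OF st]) auto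
        qed
        moreover have "(\<integral>t. (exp (- (X i * of_real t)) - exp (- (z * of_real t))) / (X i - z) \<partial>\<sigma>) = (F (X i) - F z) / (X i - z)" for i
          using intF[OF Re_pos[of i]] intF[OF z] unfolding F_def by simp
        ultimately show "((\<lambda>w. (F w - F z) / (w - z)) \<circ> X) \<longlonglongrightarrow> D"
          by (simp only: o_def)
      qed
      then have "(F has_field_derivative D) (at z within S)"
        by (simp add: has_field_derivative_iff)
      moreover have "open S" unfolding S_def by (rule open_halfspace_Re_gt)
      ultimately have "(F has_field_derivative D) (at z)" using r(2) by (metis at_within_open)
      then show "\<exists>D. (F has_field_derivative D) (at z)" by blast
    qed
  qed
qed

lemma CM_continuous_on:
  assumes "f \<in> CM" shows "continuous_on {0<..} f"
proof -
  obtain F where F: "F holomorphic_on {z. Re z > 0}" "\<And>x. x > 0 \<Longrightarrow> F (of_real x) = of_real (f x)"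
    by (rule CM_holomorphic_extension[OF assms]) (rule that)
  have "continuous_on {0<..} (\<lambda>x::real. F (of_real x))"
    by (rule continuous_on_compose2[OF holomorphic_on_imp_continuous_on[OF F(1)] continuous_on_of_real[OF continuous_on_id]]) auto
  then have "continuous_on {0<..} (\<lambda>x::real. Re (F (of_real x)))"
    by (rule continuous_on_Re)
  then show ?thesis by (rule continuous_on_eq) (simp add: F(2))
qed

definition add_measure :: "'a measure \<Rightarrow> 'a measure \<Rightarrow> 'a measure" where
  "add_measure M N = measure_of (space M) (sets M) (\<lambda>A. emeasure M A + emeasure N A)"

lemma sets_add_measure [simp, measurable_cong]: "sets (add_measure M N) = sets M"
  unfolding add_measure_def by (rule sets.sets_measure_of_eq)

lemma space_add_measure [simp]: "space (add_measure M N) = space M"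
  unfolding add_measure_def by (rule sets.space_measure_of_eq)

lemma emeasure_add_measure:
  assumes "sets N = sets M" "A \<in> sets M"
  shows "emeasure (add_measure M N) A = emeasure M A + emeasure N A"
  unfolding add_measure_def
proof (rule emeasure_measure_of_sigma)
  show "sigma_algebra (space M) (sets M)" ..
  show "positive (sets M) (\<lambda>A. emeasure M A + emeasure N A)"
    by (simp add: positive_def)
  show "countably_additive (sets M) (\<lambda>A. emeasure M A + emeasure N A)"
  proof (rule countably_additiveI)
    fix A :: "nat \<Rightarrow> 'a set" assume A: "range A \<subseteq> sets M" "disjoint_family A"
    have "(\<Sum>i. emeasure M (A i) + emeasure N (A i)) = (\<Sum>i. emeasure M (A i)) + (\<Sum>i. emeasure N (A i))"
      by (intro suminf_add[symmetric] summableI)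
    also have "\<dots> = emeasure M (\<Union>i. A i) + emeasure N (\<Union>i. A i)"
      using suminf_emeasure[of A M] suminf_emeasure[of A N] A assms(1) by simp
    finally show "(\<Sum>i. emeasure M (A i) + emeasure N (A i)) = emeasure M (\<Union>i. A i) + emeasure N (\<Union>i. A i)" .
  qed
qed fact

lemma nn_integral_add_measure:
  assumes sN: "sets N = sets M" and f: "f \<in> borel_measurable M"
  shows "(\<integral>\<^sup>+ x. f x \<partial>add_measure M N) = (\<integral>\<^sup>+ x. f x \<partial>M) + (\<integral>\<^sup>+ x. f x \<partial>N)"
  using f
proof (induction rule: borel_measurable_induct)
  case (cong f g)
  then show ?case
    using sets_eq_imp_space_eq[OF sN] by (simp cong: nn_integral_cong_simp)
next
  case (set A)
  then show ?case using sN by (simp add: emeasure_add_measure)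
next
  case (mult u c)
  moreover have "u \<in> borel_measurable N" "u \<in> borel_measurable (add_measure M N)"
    using mult sN by (auto cong: measurable_cong_sets)
  ultimately show ?case by (simp add: nn_integral_cmult distrib_left)
next
  case (add u v)
  moreover have "u \<in> borel_measurable N" "u \<in> borel_measurable (add_measure M N)"
     "v \<in> borel_measurable N" "v \<in> borel_measurable (add_measure M N)"
    using add sN by (auto cong: measurable_cong_sets)
  ultimately show ?case by (simp add: nn_integral_add ac_simps)
next
  case (seq U)
  have mU: "U i \<in> borel_measurable N" "U i \<in> borel_measurable (add_measure M N)" for i
    using seq(1)[of i] sN by (simp_all cong: measurable_cong_sets)
  have inc: "incseq (\<lambda>i. \<integral>\<^sup>+ x. U i x \<partial>M)" "incseq (\<lambda>i. \<integral>\<^sup>+ x. U i x \<partial>N)"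
    using \<open>incseq U\<close> by (auto simp: incseq_def le_fun_def intro!: nn_integral_mono)
  have *: "(\<integral>\<^sup>+ x. (SUP i. U i) x \<partial>K) = (SUP i. \<integral>\<^sup>+ x. U i x \<partial>K)" if "\<And>i. U i \<in> borel_measurable K" for K
    using nn_integral_monotone_convergence_SUP[OF seq(3) that] by (simp only: SUP_apply)
  have mM: "U i \<in> borel_measurable M" for i using seq by blast
  show ?case
    unfolding *[OF mM] *[OF mU(1)] *[OF mU(2)] seq.IH
    by (rule ennreal_SUP_add[OF inc])
qed

lemma CM_add:
  assumes "f \<in> CM" "g \<in> CM" shows "(\<lambda>x. f x + g x) \<in> CM"
proof -
  obtain \<sigma> \<tau> where s: "laplace_rep \<sigma> f" "laplace_rep \<tau> g" using assms by (auto simp: CM_iff_laplace_rep)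
  have st: "sets \<sigma> = sets (restrict_space borel {0..})" "sets \<tau> = sets \<sigma>"
    using s by (auto simp: laplace_rep_def)
  have "(\<lambda>t. ennreal (exp (- (x * t)))) \<in> borel_measurable \<sigma>" for x
    by (intro measurable_half_line[OF st(1)]) auto
  then have "laplace_rep (add_measure \<sigma> \<tau>) (\<lambda>x. f x + g x)"
    using s st unfolding laplace_rep_def by (auto simp: nn_integral_add_measure)
  then show ?thesis by (auto simp: CM_iff_laplace_rep)
qed

lemma CM_scale:
  assumes "f \<in> CM" "c \<ge> 0" shows "(\<lambda>x. c * f x) \<in> CM"
proof -
  obtain \<sigma> where s: "laplace_rep \<sigma> f" using assms by (auto simp: CM_iff_laplace_rep)
  have st: "sets \<sigma> = sets (restrict_space borel {0..})"
    using s by (auto simp: laplace_rep_def)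
  have m: "(\<lambda>t. ennreal (exp (- (x * t)))) \<in> borel_measurable \<sigma>" for x
    by (intro measurable_half_line[OF st(1)]) auto
  have "laplace_rep (scale_measure (ennreal c) \<sigma>) (\<lambda>x. c * f x)"
    using s st assms(2) unfolding laplace_rep_def by (auto simp: nn_integral_scale_measure[OF m] ennreal_mult)
  then show ?thesis by (auto simp: CM_iff_laplace_rep)
qed

lemma CM_const:
  assumes "c \<ge> 0" shows "(\<lambda>x. c) \<in> CM"
proof -
  define \<sigma> where "\<sigma> = return (restrict_space borel {0::real..}) 0"
  have "(\<lambda>t. ennreal (exp (- (x * t)))) \<in> borel_measurable (restrict_space borel {0..})" for x
    by (intro measurable_restrict_space1) auto
  then have "laplace_rep \<sigma> (\<lambda>x. 1)"
    unfolding laplace_rep_def \<sigma>_def by (auto simp: nn_integral_return space_restrict_space)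
  then have "(\<lambda>x. 1) \<in> CM" by (auto simp: CM_iff_laplace_rep)
  from CM_scale[OF this assms] show ?thesis by simp
qed

text \<open>
  Up to a factor the representing measure is an Erlang distribution with an additional
  exponential weight.
\<close>

lemma CM_shifted_power:
  assumes c: "c > 0" shows "(\<lambda>x. 1 / (x + c) ^ n) \<in> CM"
proof (cases n)
  case 0
  then show ?thesis using CM_const[of 1] by simp
next
  case (Suc k)
  define \<rho> where "\<rho> = (\<lambda>t::real. t ^ k * exp (- (c * t)) / fact k)"
  define \<sigma> where "\<sigma> = density (restrict_space lborel {0..}) (\<lambda>t. ennreal (\<rho> t))"
  have st: "sets \<sigma> = sets (restrict_space borel {0..})"
    by (simp add: \<sigma>_def sets_restrict_space)
  have m: "(\<lambda>t. ennreal (\<rho> t)) \<in> borel_measurable (restrict_space lborel {0..})"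
    unfolding \<rho>_def by (intro measurable_restrict_space1) auto
  have "(\<integral>\<^sup>+ t. ennreal (exp (- (x * t))) \<partial>\<sigma>) = ennreal (1 / (x + c) ^ n)" if "x > 0" for x
  proof -
    have xc: "x + c > 0" using that c by simp
    interpret prob_space "density lborel (erlang_density k (x + c))"
      using xc by (rule prob_space_erlang_density)
    have one: "(\<integral>\<^sup>+ t. ennreal (erlang_density k (x + c) t) \<partial>lborel) = 1"
      using emeasure_space_1 by (simp add: emeasure_density)
    have m2: "(\<lambda>t. ennreal (exp (- (x * t)))) \<in> borel_measurable (restrict_space lborel {0..})"
      by (intro measurable_restrict_space1) auto
    have "(\<integral>\<^sup>+ t. ennreal (exp (- (x * t))) \<partial>\<sigma>) = (\<integral>\<^sup>+ t. ennreal (\<rho> t) * ennreal (exp (- (x * t))) \<partial>restrict_space lborel {0..})"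
      unfolding \<sigma>_def by (rule nn_integral_density[OF m m2])
    also have "\<dots> = (\<integral>\<^sup>+ t. ennreal (\<rho> t) * ennreal (exp (- (x * t))) * indicator {0..} t \<partial>lborel)"
      by (rule nn_integral_restrict_space) auto
    also have "\<dots> = (\<integral>\<^sup>+ t. ennreal (1 / (x + c) ^ n) * ennreal (erlang_density k (x + c) t) \<partial>lborel)"
    proof (intro nn_integral_cong)
      fix t :: real
      have "\<rho> t * exp (- (x * t)) = 1 / (x + c) ^ n * ((x + c) ^ Suc k * t ^ k * exp (- (x + c) * t) / fact k)"
      proof -
        have "exp (- (c * t)) * exp (- (x * t)) = exp (- (x + c) * t)"
          by (simp add: algebra_simps flip: exp_add)
        moreover have "1 / (x + c) ^ n * ((x + c) ^ Suc k * t ^ k * exp (- (x + c) * t) / fact k)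
            = t ^ k * exp (- (x + c) * t) / fact k"
          using xc by (simp add: Suc del: power_Suc)
        ultimately show ?thesis by (simp add: \<rho>_def mult.assoc)
      qed
      then show "ennreal (\<rho> t) * ennreal (exp (- (x * t))) * indicator {0..} t =
          ennreal (1 / (x + c) ^ n) * ennreal (erlang_density k (x + c) t)"
        using xc by (auto simp: erlang_density_def ennreal_mult'[symmetric] ennreal_mult''[symmetric] simp del: power_Suc split: split_indicator)
    qed
    also have "\<dots> = ennreal (1 / (x + c) ^ n)"
      by (subst nn_integral_cmult) (simp_all only: one mult_1_right, measurable)
    finally show ?thesis .
  qed
  then have "laplace_rep \<sigma> (\<lambda>x. 1 / (x + c) ^ n)"
    unfolding laplace_rep_def using st c by auto
  then show ?thesis by (auto simp: CM_iff_laplace_rep)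
qed

section \<open>Compactness of completely monotone functions\<close>

text \<open>
  A continuous cutoff, equal to \<open>1\<close> on \<open>[0,T]\<close> and to \<open>0\<close> beyond \<open>T + 1\<close>.
\<close>

definition cutoff :: "real \<Rightarrow> real \<Rightarrow> real" where
  "cutoff T t = min 1 (max 0 (T + 1 - t))"

text \<open>
  In the variable \<open>s = exp (- t)\<close> this is the truncated Laplace kernel \<open>exp (- x t) cutoff T t\<close> divided by
  the weight \<open>exp (- t)\<close>. Clipping \<open>s\<close> from below at the end of the support of the cutoff and \<open>t\<close> from below
  at \<open>0\<close> makes it bounded and continuous on the whole line, as weak convergence requires.
\<close>

definition test_fun :: "real \<Rightarrow> real \<Rightarrow> real \<Rightarrow> real" where
  "test_fun x T s = (let t = max 0 (- ln (max s (exp (- (T + 1))))) in exp ((1 - x) * t) * cutoff T t)"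

lemma cutoff_bounds: "0 \<le> cutoff T t" "cutoff T t \<le> 1"
  by (auto simp: cutoff_def)

lemma borel_measurable_cutoff [measurable]: "cutoff T \<in> borel_measurable borel"
  unfolding cutoff_def[abs_def] by measurable

lemma test_fun_nonneg: "0 \<le> test_fun x T s"
  by (simp add: test_fun_def Let_def cutoff_bounds)

lemma test_fun_isCont: "isCont (test_fun x T) s"
proof -
  have "max s (exp (- (T + 1))) \<noteq> 0" by (smt (verit) exp_gt_zero)
  then show ?thesis
    unfolding test_fun_def[abs_def] Let_def cutoff_def by (intro continuous_intros)
qed

lemma test_fun_bounded:
  assumes "T \<ge> 0" shows "\<bar>test_fun x T s\<bar> \<le> exp (\<bar>1 - x\<bar> * (T + 1))"
proof -
  define t where "t = max 0 (- ln (max s (exp (- (T + 1)))))"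
  have "ln (exp (- (T + 1))) \<le> ln (max s (exp (- (T + 1))))"
    by (intro ln_mono) auto
  then have t: "0 \<le> t" "t \<le> T + 1" using assms by (auto simp: t_def)
  have "(1 - x) * t \<le> \<bar>1 - x\<bar> * (T + 1)"
    using t by (intro mult_mono) auto
  then have "exp ((1 - x) * t) * cutoff T t \<le> exp (\<bar>1 - x\<bar> * (T + 1)) * 1"
    by (intro mult_mono) (auto simp: cutoff_bounds)
  then show ?thesis
    using test_fun_nonneg[of x T s] by (simp add: test_fun_def Let_def t_def)
qed

lemma test_fun_nonpos:
  assumes "T \<ge> 0" "s \<le> 0" shows "test_fun x T s = 0"
proof -
  have "max s (exp (- (T + 1))) = exp (- (T + 1))" using assms by (smt (verit) exp_gt_zero)
  then show ?thesis using assms by (simp add: test_fun_def Let_def cutoff_def)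
qed

lemma test_fun_pos:
  assumes "T \<ge> 0" "s > 0"
  defines "t \<equiv> max 0 (- ln s)"
  shows "test_fun x T s = exp ((1 - x) * t) * cutoff T t"
proof (cases "s \<ge> exp (- (T + 1))")
  case True
  then show ?thesis by (simp add: test_fun_def t_def Let_def max_def)
next
  case False
  then have "ln s < ln (exp (- (T + 1)))" using assms by (subst ln_less_cancel_iff) auto
  then have "cutoff T t = 0" using assms by (auto simp: t_def cutoff_def)
  moreover have "max s (exp (- (T + 1))) = exp (- (T + 1))" using False by simp
  ultimately show ?thesis using assms by (simp add: test_fun_def Let_def cutoff_def)
qed

lemma test_fun_exp:
  assumes "T \<ge> 0" "t \<ge> 0"
  shows "test_fun x T (exp (- t)) * exp (- t) = exp (- (x * t)) * cutoff T t"
proof -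
  have "test_fun x T (exp (- t)) * exp (- t) = exp ((1 - x) * t) * exp (- t) * cutoff T t"
    using assms by (simp add: test_fun_pos)
  also have "exp ((1 - x) * t) * exp (- t) = exp (- (x * t))"
    by (simp add: algebra_simps flip: exp_add)
  finally show ?thesis .
qed

text \<open>
  The tail of a Laplace integral at \<open>x\<close> is exponentially small in \<open>T\<close> relative to the
  integral at \<open>x/2\<close>. This makes the truncation uniform over all functions with a common bound
  at \<open>x/2\<close>.
\<close>

lemma cutoff_tail:
  assumes "x > 0" "t \<ge> 0" "T \<ge> 0"
  shows "exp (- (x * t)) \<le> exp (- (x * t)) * cutoff T t + exp (- (x * T / 2)) * exp (- (x / 2 * t))"
proof (cases "t \<le> T")
  case True
  then have "cutoff T t = 1" by (simp add: cutoff_def)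
  then show ?thesis by simp
next
  case False
  then have "x * T \<le> x * t" using assms by (intro mult_left_mono) auto
  then have "exp (- (x * t)) \<le> exp (- (x * T / 2) + - (x / 2 * t))"
    by simp
  then have "exp (- (x * t)) \<le> exp (- (x * T / 2)) * exp (- (x / 2 * t))" by (simp only: exp_add)
  moreover have "0 \<le> exp (- (x * t)) * cutoff T t" by (simp add: cutoff_bounds)
  ultimately show ?thesis by linarith
qed

lemma tendsto_of_uniform_approximation:
  fixes A :: "nat \<Rightarrow> nat \<Rightarrow> real"
  assumes A: "\<And>T. (\<lambda>n. A n T) \<longlonglongrightarrow> B T" and B: "B \<longlonglongrightarrow> g" and e: "e \<longlonglongrightarrow> 0"
    and fA: "\<And>n T. \<bar>f n - A n T\<bar> \<le> e T"
  shows "f \<longlonglongrightarrow> g"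
proof (rule LIMSEQ_I)
  fix r :: real assume "r > 0"
  then have r: "r / 3 > 0" by simp
  have "eventually (\<lambda>T. \<bar>B T - g\<bar> < r / 3 \<and> \<bar>e T\<bar> < r / 3) sequentially"
    using tendstoD[OF B r] tendstoD[OF e r] by eventually_elim (simp add: dist_real_def)
  then obtain T where T: "\<bar>B T - g\<bar> < r / 3" "\<bar>e T\<bar> < r / 3"
    using eventually_happens'[OF sequentially_bot] by blast
  obtain N where N: "\<And>n. n \<ge> N \<Longrightarrow> \<bar>A n T - B T\<bar> < r / 3"
    using LIMSEQ_D[OF A r, of T] by auto
  have "\<bar>f n - g\<bar> < r" if "n \<ge> N" for n
    using N[OF that] T fA[of n T] by linarith
  then show "\<exists>N. \<forall>n\<ge>N. norm (f n - g) < r" by (auto intro!: exI[of _ N])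
qed

lemma laplace_repD: "laplace_rep \<sigma> f \<Longrightarrow> x > 0 \<Longrightarrow> (\<integral>\<^sup>+ t. ennreal (exp (- (x * t))) \<partial>\<sigma>) = ennreal (f x)"
  by (simp add: laplace_rep_def)

text \<open>
  The measure \<open>exp (- t) \<sigma>(dt) / K\<close> is moved to \<open>[0,1]\<close> by \<open>s = exp (- t)\<close> and completed to a
  probability measure by an atom at \<open>s = 0\<close>, the image of \<open>t = \<infinity>\<close>. There all test functions vanish,
  so the atom does not affect their integrals.
\<close>

definition compactify :: "real \<Rightarrow> real measure \<Rightarrow> real measure" where
  "compactify K \<sigma> = (let \<nu> = distr (density \<sigma> (\<lambda>t. ennreal (exp (- t) / K))) borel (\<lambda>t. exp (- t))
     in add_measure \<nu> (scale_measure (1 - emeasure \<nu> UNIV) (return borel 0)))"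

lemma sets_compactify [simp, measurable_cong]: "sets (compactify K \<sigma>) = sets borel"
  by (simp add: compactify_def Let_def)

lemma nn_integral_compactify:
  assumes \<sigma>: "laplace_rep \<sigma> f" and K: "K > 0" and h: "h \<in> borel_measurable borel"
  shows "(\<integral>\<^sup>+ s. h s \<partial>compactify K \<sigma>) =
    (\<integral>\<^sup>+ t. ennreal (exp (- t) / K) * h (exp (- t)) \<partial>\<sigma>) + (1 - ennreal (f 1 / K)) * h 0"
proof -
  have st: "sets \<sigma> = sets (restrict_space borel {0..})" using \<sigma> by (auto simp: laplace_rep_def)
  note m = measurable_half_line[OF st]
  define \<nu> where "\<nu> = distr (density \<sigma> (\<lambda>t. ennreal (exp (- t) / K))) borel (\<lambda>t. exp (- t))"
  have d: "(\<lambda>t. ennreal (exp (- t) / K)) \<in> borel_measurable \<sigma>" by (rule m) measurable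
  have e: "(\<lambda>t. exp (- t)) \<in> measurable (density \<sigma> (\<lambda>t. ennreal (exp (- t) / K))) borel"
    unfolding measurable_density_eq1 by (rule m) measurable
  have \<nu>: "(\<integral>\<^sup>+ s. h s \<partial>\<nu>) = (\<integral>\<^sup>+ t. ennreal (exp (- t) / K) * h (exp (- t)) \<partial>\<sigma>)"
    if h: "h \<in> borel_measurable borel" for h
  proof -
    have "(\<lambda>t. h (exp (- t))) \<in> borel_measurable \<sigma>"
      by (rule m, rule measurable_compose[OF _ h]) measurable
    then show ?thesis
      unfolding \<nu>_def by (simp add: nn_integral_distr[OF e] h nn_integral_density[OF d])
  qed
  have "emeasure \<nu> UNIV = (\<integral>\<^sup>+ s. 1 \<partial>\<nu>)" by (simp add: \<nu>_def)
  also have "\<dots> = (\<integral>\<^sup>+ t. ennreal (1 / K) * ennreal (exp (- (1 * t))) \<partial>\<sigma>)"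
    using K by (subst \<nu>) (auto intro!: nn_integral_cong simp: ennreal_mult[symmetric])
  also have "\<dots> = ennreal (1 / K) * ennreal (f 1)"
  proof -
    have "(\<lambda>t. ennreal (exp (- (1 * t)))) \<in> borel_measurable \<sigma>" by (rule m) measurable
    then show ?thesis
      using laplace_repD[OF \<sigma> zero_less_one] by (simp only: nn_integral_cmult)
  qed
  also have "\<dots> = ennreal (f 1 / K)"
    using K by (simp add: ennreal_mult'[symmetric])
  finally have tot: "emeasure \<nu> UNIV = ennreal (f 1 / K)" .
  have sn: "sets \<nu> = sets borel" by (simp add: \<nu>_def)
  have "(\<integral>\<^sup>+ s. h s \<partial>compactify K \<sigma>) = (\<integral>\<^sup>+ s. h s \<partial>\<nu>) + (\<integral>\<^sup>+ s. h s \<partial>scale_measure (1 - emeasure \<nu> UNIV) (return borel 0))"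
    unfolding compactify_def Let_def \<nu>_def[symmetric]
    by (rule nn_integral_add_measure) (use sn h in \<open>simp_all cong: measurable_cong_sets\<close>)
  also have "\<dots> = (\<integral>\<^sup>+ t. ennreal (exp (- t) / K) * h (exp (- t)) \<partial>\<sigma>) + (1 - ennreal (f 1 / K)) * h 0"
    using h by (simp add: \<nu> tot nn_integral_scale_measure nn_integral_return)
  finally show ?thesis .
qed

lemma compactify_interval:
  assumes \<sigma>: "laplace_rep \<sigma> f" and K: "K > 0" "f 1 \<le> K" and A: "A \<in> sets borel" "{0..1} \<subseteq> A"
  shows "emeasure (compactify K \<sigma>) A = 1"
proof -
  have st: "sets \<sigma> = sets (restrict_space borel {0..})" using \<sigma> by (auto simp: laplace_rep_def)
  note m = measurable_half_line[OF st]
  have sp: "space \<sigma> = {0..}" by (rule space_half_line[OF st])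
  have "0 \<le> f 1" using \<sigma> by (auto simp: laplace_rep_def)
  then have f1K: "0 \<le> f 1 / K" "f 1 / K \<le> 1" using K by auto
  have "emeasure (compactify K \<sigma>) A = (\<integral>\<^sup>+ s. indicator A s \<partial>compactify K \<sigma>)"
    using A by simp
  also have "\<dots> = (\<integral>\<^sup>+ t. ennreal (exp (- t) / K) * indicator A (exp (- t)) \<partial>\<sigma>) + (1 - ennreal (f 1 / K)) * indicator A 0"
    by (rule nn_integral_compactify[OF \<sigma> K(1)]) (use A in simp)
  also have "(\<integral>\<^sup>+ t. ennreal (exp (- t) / K) * indicator A (exp (- t)) \<partial>\<sigma>) = (\<integral>\<^sup>+ t. ennreal (1 / K) * ennreal (exp (- (1 * t))) \<partial>\<sigma>)"
  proof (rule nn_integral_cong)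
    fix t assume "t \<in> space \<sigma>"
    then have "exp (- t) \<in> A" using A sp by auto
    then show "ennreal (exp (- t) / K) * indicator A (exp (- t)) = ennreal (1 / K) * ennreal (exp (- (1 * t)))"
      using K by (simp add: ennreal_mult'[symmetric])
  qed
  also have "\<dots> = ennreal (1 / K) * ennreal (f 1)"
  proof -
    have "(\<lambda>t. ennreal (exp (- (1 * t)))) \<in> borel_measurable \<sigma>" by (rule m) measurable
    then show ?thesis
      using laplace_repD[OF \<sigma> zero_less_one] by (simp only: nn_integral_cmult)
  qed
  also have "\<dots> = ennreal (f 1 / K)"
    using K by (simp add: ennreal_mult'[symmetric])
  also have "(1 - ennreal (f 1 / K)) * indicator A 0 = ennreal (1 - f 1 / K)"
  proof -
    have "1 - ennreal (f 1 / K) = ennreal (1 - f 1 / K)"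
      using f1K by (metis ennreal_1 ennreal_minus)
    moreover have "0 \<in> A" using A by auto
    ultimately show ?thesis by simp
  qed
  also have "ennreal (f 1 / K) + ennreal (1 - f 1 / K) = ennreal (f 1 / K + (1 - f 1 / K))"
    using f1K by (intro ennreal_plus[symmetric]) auto
  finally show ?thesis by simp
qed

lemma nn_integral_compactify_test_fun:
  assumes \<sigma>: "laplace_rep \<sigma> f" and K: "K > 0" and T: "T \<ge> 0"
  shows "(\<integral>\<^sup>+ s. ennreal (K * test_fun x T s) \<partial>compactify K \<sigma>) = (\<integral>\<^sup>+ t. ennreal (exp (- (x * t)) * cutoff T t) \<partial>\<sigma>)"
proof -
  have st: "sets \<sigma> = sets (restrict_space borel {0..})" using \<sigma> by (auto simp: laplace_rep_def)
  have sp: "space \<sigma> = {0..}" by (rule space_half_line[OF st])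
  have mt: "test_fun x T \<in> borel_measurable borel"
    by (intro borel_measurable_continuous_onI continuous_at_imp_continuous_on) (simp add: test_fun_isCont)
  have "(\<integral>\<^sup>+ s. ennreal (K * test_fun x T s) \<partial>compactify K \<sigma>) =
    (\<integral>\<^sup>+ t. ennreal (exp (- t) / K) * ennreal (K * test_fun x T (exp (- t))) \<partial>\<sigma>) + (1 - ennreal (f 1 / K)) * ennreal (K * test_fun x T 0)"
    by (rule nn_integral_compactify[OF \<sigma> K]) (use mt in measurable)
  also have "test_fun x T 0 = 0" using T by (simp add: test_fun_nonpos)
  also have "(\<integral>\<^sup>+ t. ennreal (exp (- t) / K) * ennreal (K * test_fun x T (exp (- t))) \<partial>\<sigma>)
     = (\<integral>\<^sup>+ t. ennreal (exp (- (x * t)) * cutoff T t) \<partial>\<sigma>)"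
  proof (rule nn_integral_cong)
    fix t assume "t \<in> space \<sigma>"
    then have "t \<ge> 0" using sp by simp
    have "ennreal (exp (- t) / K) * ennreal (K * test_fun x T (exp (- t))) = ennreal (exp (- t) / K * (K * test_fun x T (exp (- t))))"
      using K by (intro ennreal_mult[symmetric]) (auto simp: test_fun_nonneg)
    also have "exp (- t) / K * (K * test_fun x T (exp (- t))) = exp (- (x * t)) * cutoff T t"
      using test_fun_exp[OF T \<open>t \<ge> 0\<close>, of x] K by (simp add: mult.commute)
    finally show "ennreal (exp (- t) / K) * ennreal (K * test_fun x T (exp (- t))) = ennreal (exp (- (x * t)) * cutoff T t)" .
  qed
  finally show ?thesis by simp
qed

lemma real_distribution_compactify:
  assumes \<sigma>: "laplace_rep \<sigma> f" and K: "K > 0" "f 1 \<le> K"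
  shows "real_distribution (compactify K \<sigma>)"
proof -
  have "space (compactify K \<sigma>) = UNIV"
    using sets_eq_imp_space_eq[OF sets_compactify] by simp
  then have "emeasure (compactify K \<sigma>) (space (compactify K \<sigma>)) = 1"
    using compactify_interval[OF \<sigma> K, of UNIV] by simp
  then interpret prob_space "compactify K \<sigma>" by (rule prob_spaceI)
  show ?thesis by unfold_locales simp
qed

text \<open>
  The way back from \<open>s\<close> to \<open>t = - ln s\<close>. What a limit measure carries at \<open>s = 0\<close> is discarded; it
  includes all mass that escaped to \<open>t = \<infinity>\<close>.
\<close>

definition uncompactify :: "real \<Rightarrow> real measure \<Rightarrow> real measure" where
  "uncompactify K M = distr (density M (\<lambda>s. if s > 0 then ennreal (K * exp (max 0 (- ln s))) else 0))
     (restrict_space borel {0..}) (\<lambda>s. max 0 (- ln s))"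

lemma nn_integral_uncompactify_cutoff:
  assumes M: "sets M = sets borel" and K: "K > 0" and T: "T \<ge> 0"
  shows "(\<integral>\<^sup>+ t. ennreal (exp (- (x * t)) * cutoff T t) \<partial>uncompactify K M) = (\<integral>\<^sup>+ s. ennreal (K * test_fun x T s) \<partial>M)"
proof -
  have d: "(\<lambda>s. if s > 0 then ennreal (K * exp (max 0 (- ln s))) else 0) \<in> borel_measurable M"
    unfolding measurable_cong_sets[OF M refl] by measurable
  have e: "(\<lambda>s::real. max 0 (- ln s)) \<in> measurable (density M (\<lambda>s. if s > 0 then ennreal (K * exp (max 0 (- ln s))) else 0)) (restrict_space borel {0..})"
    unfolding measurable_density_eq1 measurable_cong_sets[OF M refl] by (intro measurable_restrict_space2) auto
  have h: "(\<lambda>t. ennreal (exp (- (x * t)) * cutoff T t)) \<in> borel_measurable (restrict_space borel {0..})"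
    by (intro measurable_restrict_space1) measurable
  have he: "(\<lambda>s. ennreal (exp (- (x * max 0 (- ln s))) * cutoff T (max 0 (- ln s)))) \<in> borel_measurable M"
    unfolding measurable_cong_sets[OF M refl] by measurable
  have "(\<integral>\<^sup>+ t. ennreal (exp (- (x * t)) * cutoff T t) \<partial>uncompactify K M)
    = (\<integral>\<^sup>+ s. ennreal (exp (- (x * max 0 (- ln s))) * cutoff T (max 0 (- ln s))) \<partial>density M (\<lambda>s. if s > 0 then ennreal (K * exp (max 0 (- ln s))) else 0))"
    unfolding uncompactify_def by (rule nn_integral_distr[OF e]) (simp add: h)
  also have "\<dots> = (\<integral>\<^sup>+ s. (if s > 0 then ennreal (K * exp (max 0 (- ln s))) else 0) * ennreal (exp (- (x * max 0 (- ln s))) * cutoff T (max 0 (- ln s))) \<partial>M)"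
    by (rule nn_integral_density[OF d he])
  also have "\<dots> = (\<integral>\<^sup>+ s. ennreal (K * test_fun x T s) \<partial>M)"
  proof (rule nn_integral_cong)
    fix s :: real
    show "(if s > 0 then ennreal (K * exp (max 0 (- ln s))) else 0) * ennreal (exp (- (x * max 0 (- ln s))) * cutoff T (max 0 (- ln s))) = ennreal (K * test_fun x T s)"
    proof (cases "s > 0")
      case True
      define t where "t = max 0 (- ln s)"
      have "exp ((1 - x) * t) = exp t * exp (- (x * t))" by (simp add: algebra_simps flip: exp_add)
      then have "K * test_fun x T s = (K * exp t) * (exp (- (x * t)) * cutoff T t)"
        using True T by (simp add: test_fun_pos t_def)
      then show ?thesis using True K cutoff_bounds(1)[of T t] unfolding t_def[symmetric] by (simp add: ennreal_mult mult.assoc)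
    qed (use T in \<open>simp add: test_fun_nonpos\<close>)
  qed
  finally show ?thesis .
qed

lemma laplace_cutoff_approx:
  assumes \<sigma>: "laplace_rep \<sigma> f" and x: "x > 0" and T: "T \<ge> 0"
  shows "\<bar>f x - enn2real (\<integral>\<^sup>+ t. ennreal (exp (- (x * t)) * cutoff T t) \<partial>\<sigma>)\<bar> \<le> exp (- (x * T / 2)) * f (x / 2)"
proof -
  have st: "sets \<sigma> = sets (restrict_space borel {0..})" using \<sigma> by (auto simp: laplace_rep_def)
  have sp: "space \<sigma> = {0..}" by (rule space_half_line[OF st])
  note m = measurable_half_line[OF st]
  define I where "I = (\<integral>\<^sup>+ t. ennreal (exp (- (x * t)) * cutoff T t) \<partial>\<sigma>)"
  have m1: "(\<lambda>t. ennreal (exp (- (x * t)) * cutoff T t)) \<in> borel_measurable \<sigma>" by (rule m) measurable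
  have m2: "(\<lambda>t. ennreal (exp (- (x / 2 * t)))) \<in> borel_measurable \<sigma>" by (rule m) measurable
  have fx: "ennreal (f x) = (\<integral>\<^sup>+ t. ennreal (exp (- (x * t))) \<partial>\<sigma>)" "f x \<ge> 0"
    and fx2: "(\<integral>\<^sup>+ t. ennreal (exp (- (x / 2 * t))) \<partial>\<sigma>) = ennreal (f (x / 2))" "f (x / 2) \<ge> 0"
    using \<sigma> x laplace_repD[OF \<sigma> x] laplace_repD[OF \<sigma>, of "x / 2"] by (auto simp: laplace_rep_def)
  have "I \<le> ennreal (f x)"
    unfolding I_def fx(1) by (intro nn_integral_mono ennreal_leI mult_left_le) (auto simp: cutoff_bounds)
  then obtain i where i: "I = ennreal i" "0 \<le> i" "i \<le> f x"
    using fx(2) by (metis ennreal_le_iff ennreal_enn2real enn2real_nonneg ennreal_less_top le_less_trans)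
  have "ennreal (f x) \<le> (\<integral>\<^sup>+ t. ennreal (exp (- (x * t)) * cutoff T t) + ennreal (exp (- (x * T / 2))) * ennreal (exp (- (x / 2 * t))) \<partial>\<sigma>)"
    unfolding fx(1)
  proof (rule nn_integral_mono)
    fix t assume "t \<in> space \<sigma>"
    then have "t \<ge> 0" using sp by simp
    then show "ennreal (exp (- (x * t))) \<le> ennreal (exp (- (x * t)) * cutoff T t) + ennreal (exp (- (x * T / 2))) * ennreal (exp (- (x / 2 * t)))"
      using cutoff_tail[OF x _ T, of t] cutoff_bounds(1)[of T t]
      by (simp only: ennreal_mult[symmetric] ennreal_plus[symmetric] exp_ge_zero mult_nonneg_nonneg ennreal_leI)
  qed
  also have "\<dots> = I + ennreal (exp (- (x * T / 2))) * ennreal (f (x / 2))"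
    unfolding I_def fx2(1)[symmetric] nn_integral_cmult[OF m2, symmetric]
    by (rule nn_integral_add[OF m1]) (use m2 in measurable)
  also have "\<dots> = ennreal (i + exp (- (x * T / 2)) * f (x / 2))"
    using i fx2(2) by (simp add: ennreal_mult)
  finally have "f x \<le> i + exp (- (x * T / 2)) * f (x / 2)"
    using i fx2(2) by (subst (asm) ennreal_le_iff) auto
  then show ?thesis using i unfolding I_def[symmetric] by simp
qed

text \<open>
  Helly's theorem for the compactified measures: they live on \<open>[0,1]\<close> and are therefore tight,
  so a subsequence converges weakly. Weak convergence gives the limits of the truncated Laplace
  integrals, and the truncation error is uniform by \<open>laplace_cutoff_approx\<close>.
\<close>

lemma CM_compactness:
  assumes f: "\<And>n. f n \<in> CM" and b: "\<And>n x. x > 0 \<Longrightarrow> f n x \<le> b x"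
  shows "\<exists>(r :: nat \<Rightarrow> nat) g. strict_mono r \<and> g \<in> CM \<and> (\<forall>x>0. (\<lambda>n. f (r n) x) \<longlonglongrightarrow> g x)"
proof -
  obtain \<sigma> where \<sigma>: "\<And>n. laplace_rep (\<sigma> n) (f n)"
    using f unfolding CM_iff_laplace_rep by metis
  define K where "K = max 1 (b 1)"
  have K: "K > 0" "f n 1 \<le> K" for n
    using b[of 1 n] by (auto simp: K_def)
  define \<mu> where "\<mu> n = compactify K (\<sigma> n)" for n
  have "tight \<mu>"
    unfolding tight_def
  proof (intro conjI allI impI)
    show "real_distribution (\<mu> n)" for n
      unfolding \<mu>_def by (rule real_distribution_compactify[OF \<sigma> K])
    fix \<epsilon> :: real assume "\<epsilon> > 0"
    have "measure (\<mu> n) {-1<..1} = 1" for n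
      unfolding \<mu>_def measure_def by (subst compactify_interval[OF \<sigma> K]) auto
    then show "\<exists>a b. a < b \<and> (\<forall>n. 1 - \<epsilon> < measure (\<mu> n) {a<..b})"
      using \<open>\<epsilon> > 0\<close> by (intro exI[of _ "-1"] exI[of _ 1]) simp
  qed
  from tight_imp_convergent_subsubsequence[OF this, of id]
  obtain r M where r: "strict_mono (r :: nat \<Rightarrow> nat)" and M: "real_distribution M"
    and w: "weak_conv_m (\<mu> \<circ> id \<circ> r) M"
    by (auto simp: strict_mono_def)
  interpret M: real_distribution M by fact
  have rd: "real_distribution ((\<mu> \<circ> id \<circ> r) n)" for n
    unfolding o_def \<mu>_def by (rule real_distribution_compactify[OF \<sigma> K])
  define \<tau> where "\<tau> = uncompactify K M"
  have st: "sets \<tau> = sets (restrict_space borel {0..})"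
    by (simp add: \<tau>_def uncompactify_def)
  note m = measurable_half_line[OF st]
  define A where "A x n T = enn2real (\<integral>\<^sup>+ t. ennreal (exp (- (x * t)) * cutoff (real T) t) \<partial>\<sigma> (r n))" for x n T
  define B where "B x T = enn2real (\<integral>\<^sup>+ t. ennreal (exp (- (x * t)) * cutoff (real T) t) \<partial>\<tau>)" for x T
  have mt: "test_fun x T \<in> borel_measurable borel" for x T
    by (intro borel_measurable_continuous_onI continuous_at_imp_continuous_on) (simp add: test_fun_isCont)
  have A_eq: "A x n T = K * (\<integral>s. test_fun x T s \<partial>(\<mu> \<circ> id \<circ> r) n)" for x n T
  proof -
    have "K * (\<integral>s. test_fun x T s \<partial>compactify K (\<sigma> (r n))) = (\<integral>s. K * test_fun x T s \<partial>compactify K (\<sigma> (r n)))"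
      by simp
    also have "\<dots> = A x n T"
      unfolding A_def nn_integral_compactify_test_fun[OF \<sigma> K(1) of_nat_0_le_iff, symmetric]
      using mt[of x T] K(1) by (intro integral_eq_nn_integral) (auto simp: test_fun_nonneg)
    finally show ?thesis by (simp add: \<mu>_def)
  qed
  have B_eq: "ennreal (B x T) = (\<integral>\<^sup>+ t. ennreal (exp (- (x * t)) * cutoff (real T) t) \<partial>\<tau>)"
      "B x T = K * (\<integral>s. test_fun x T s \<partial>M)" for x T
  proof -
    have int: "integrable M (\<lambda>s. K * test_fun x T s)"
    proof (rule integrable_mult_right, rule M.integrable_const_bound)
      show "AE s in M. norm (test_fun x T s) \<le> exp (\<bar>1 - x\<bar> * (real T + 1))"
        by (rule AE_I2) (unfold real_norm_def, rule test_fun_bounded, simp)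
      show "test_fun x T \<in> borel_measurable M" using mt by simp
    qed
    have "(\<integral>\<^sup>+ t. ennreal (exp (- (x * t)) * cutoff (real T) t) \<partial>\<tau>) = (\<integral>\<^sup>+ s. ennreal (K * test_fun x T s) \<partial>M)"
      unfolding \<tau>_def by (rule nn_integral_uncompactify_cutoff) (use K in auto)
    also have "\<dots> = ennreal (\<integral>s. K * test_fun x T s \<partial>M)"
      using K(1) by (intro nn_integral_eq_integral[OF int]) (auto simp: test_fun_nonneg)
    finally have *: "(\<integral>\<^sup>+ t. ennreal (exp (- (x * t)) * cutoff (real T) t) \<partial>\<tau>) = ennreal (K * (\<integral>s. test_fun x T s \<partial>M))"
      by simp
    have "0 \<le> K * (\<integral>s. test_fun x T s \<partial>M)"
      using K(1) by (intro mult_nonneg_nonneg integral_nonneg_AE) (auto simp: test_fun_nonneg)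
    then show "B x T = K * (\<integral>s. test_fun x T s \<partial>M)" "ennreal (B x T) = (\<integral>\<^sup>+ t. ennreal (exp (- (x * t)) * cutoff (real T) t) \<partial>\<tau>)"
      unfolding B_def * by simp_all
  qed
  have A_B: "(\<lambda>n. A x n T) \<longlonglongrightarrow> B x T" for x T
    unfolding A_eq B_eq(2)
    by (intro tendsto_mult_left weak_conv_imp_integral_bdd_continuous_conv[OF rd M w, where B = "exp (\<bar>1 - x\<bar> * (real T + 1))"])
       (use test_fun_bounded[of "real T" x] in \<open>simp_all add: test_fun_isCont\<close>)
  have A_le: "A x n T \<le> b x" if "x > 0" for x n T
  proof -
    have "ennreal (f (r n) x) = (\<integral>\<^sup>+ t. ennreal (exp (- (x * t))) \<partial>\<sigma> (r n))" "0 \<le> f (r n) x"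
      using laplace_repD[OF \<sigma> that, of "r n"] CM_nonneg[OF f that] by simp_all
    moreover have "(\<integral>\<^sup>+ t. ennreal (exp (- (x * t)) * cutoff (real T) t) \<partial>\<sigma> (r n)) \<le> (\<integral>\<^sup>+ t. ennreal (exp (- (x * t))) \<partial>\<sigma> (r n))"
      by (intro nn_integral_mono ennreal_leI mult_left_le) (auto simp: cutoff_bounds)
    ultimately have "A x n T \<le> f (r n) x"
      unfolding A_def by (metis enn2real_leI)
    then show ?thesis using b[OF that, of "r n"] by linarith
  qed
  have B_le: "B x T \<le> b x" if "x > 0" for x T
    using A_B A_le[OF that] by (blast intro: LIMSEQ_le_const2)
  have sup: "(\<integral>\<^sup>+ t. ennreal (exp (- (x * t))) \<partial>\<tau>) = (SUP T. ennreal (B x T))" for x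
  proof -
    have "(\<integral>\<^sup>+ t. (SUP T. ennreal (exp (- (x * t)) * cutoff (real T) t)) \<partial>\<tau>) = (SUP T. ennreal (B x T))"
      unfolding B_eq(1)
      by (intro nn_integral_monotone_convergence_SUP m)
         (auto simp: incseq_def le_fun_def cutoff_def intro!: ennreal_leI mult_left_mono)
    moreover have "(SUP T. ennreal (exp (- (x * t)) * cutoff (real T) t)) = ennreal (exp (- (x * t)))" for t
    proof (rule antisym)
      show "(SUP T. ennreal (exp (- (x * t)) * cutoff (real T) t)) \<le> ennreal (exp (- (x * t)))"
        by (intro SUP_least ennreal_leI mult_left_le) (auto simp: cutoff_bounds)
      have "cutoff (real (nat \<lceil>t\<rceil>)) t = 1" by (auto simp: cutoff_def) linarith
      then show "ennreal (exp (- (x * t))) \<le> (SUP T. ennreal (exp (- (x * t)) * cutoff (real T) t))"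
        by (intro SUP_upper2[of "nat \<lceil>t\<rceil>"]) auto
    qed
    ultimately show ?thesis by simp
  qed
  define g where "g x = enn2real (\<integral>\<^sup>+ t. ennreal (exp (- (x * t))) \<partial>\<tau>)" for x
  have g: "(\<integral>\<^sup>+ t. ennreal (exp (- (x * t))) \<partial>\<tau>) = ennreal (g x)" if "x > 0" for x
  proof -
    have "(\<integral>\<^sup>+ t. ennreal (exp (- (x * t))) \<partial>\<tau>) \<le> ennreal (b x)"
      unfolding sup using B_le[OF that] by (intro SUP_least ennreal_leI)
    then show ?thesis unfolding g_def by (metis ennreal_enn2real ennreal_less_top le_less_trans)
  qed
  have "laplace_rep \<tau> g" using st g by (auto simp: laplace_rep_def g_def)
  have B_g: "B x \<longlonglongrightarrow> g x" if "x > 0" for x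
  proof -
    have "incseq (\<lambda>T. ennreal (B x T))"
      unfolding B_eq(1) by (auto simp: incseq_def cutoff_def intro!: nn_integral_mono ennreal_leI mult_left_mono)
    then have "(\<lambda>T. ennreal (B x T)) \<longlonglongrightarrow> (SUP T. ennreal (B x T))" by (rule LIMSEQ_SUP)
    then have "(\<lambda>T. ennreal (B x T)) \<longlonglongrightarrow> ennreal (g x)" using sup[of x] g[OF that] by simp
    then show ?thesis by (rule tendsto_ennrealD) (auto simp: B_def g_def)
  qed
  have "(\<lambda>n. f (r n) x) \<longlonglongrightarrow> g x" if x: "x > 0" for x
  proof (rule tendsto_of_uniform_approximation[OF A_B B_g[OF x]])
    show "(\<lambda>T::nat. exp (- (x * T / 2)) * b (x / 2)) \<longlonglongrightarrow> 0"
      using x by real_asymp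
    show "\<bar>f (r n) x - A x n T\<bar> \<le> exp (- (x * T / 2)) * b (x / 2)" for n T
    proof -
      have "\<bar>f (r n) x - A x n T\<bar> \<le> exp (- (x * T / 2)) * f (r n) (x / 2)"
        unfolding A_def by (rule laplace_cutoff_approx[OF \<sigma> x]) simp
      also have "\<dots> \<le> exp (- (x * T / 2)) * b (x / 2)"
        using x by (intro mult_left_mono b) auto
      finally show ?thesis .
    qed
  qed
  then show ?thesis using r \<open>laplace_rep \<tau> g\<close> CM_iff_laplace_rep by blast
qed

section \<open>The square norm on the unit interval\<close>

abbreviation unit_interval :: "real set" where "unit_interval \<equiv> {0<..<1}"

lemma CM_measurable:
  assumes "f \<in> CM" shows "set_borel_measurable lborel unit_interval f"
proof -
  have "continuous_on unit_interval f"
    by (rule continuous_on_subset[OF CM_continuous_on[OF assms]]) auto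
  then show ?thesis
    unfolding set_borel_measurable_def measurable_lborel1
    using borel_measurable_continuous_on_indicator[of unit_interval f] by simp
qed

lemma l2norm_nonneg: "0 \<le> l2norm f"
  by (auto simp: l2norm_def set_lebesgue_integral_def intro!: integral_nonneg_AE)

lemma l2norm_sq: "(l2norm f)\<^sup>2 = (LINT x:unit_interval|lborel. (f x)\<^sup>2)"
  unfolding l2norm_def by (rule real_sqrt_pow2) (auto simp: set_lebesgue_integral_def intro!: integral_nonneg_AE)

lemma l2norm_cong:
  assumes "\<And>x. 0 < x \<Longrightarrow> x < 1 \<Longrightarrow> f x = g x" shows "l2norm f = l2norm g"
  unfolding l2norm_def using assms by (intro arg_cong[of _ _ sqrt] set_lebesgue_integral_cong) auto

lemma l2norm_scale: "l2norm (\<lambda>x. c * f x) = \<bar>c\<bar> * l2norm f"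
  by (simp add: l2norm_def power_mult_distrib real_sqrt_mult)

lemma square_measurable:
  fixes h :: "real \<Rightarrow> real"
  assumes "set_borel_measurable lborel unit_interval h"
  shows "(\<lambda>x. indicator unit_interval x *\<^sub>R (h x)\<^sup>2) \<in> borel_measurable lborel"
proof -
  have "(\<lambda>x. indicator unit_interval x *\<^sub>R (h x)\<^sup>2) = (\<lambda>x. (indicator unit_interval x *\<^sub>R h x)\<^sup>2)"
    by (auto simp: fun_eq_iff indicator_def)
  then show ?thesis using assms unfolding set_borel_measurable_def by simp
qed

lemma nn_integral_square_unit:
  assumes "set_integrable lborel unit_interval (\<lambda>x. (h x)\<^sup>2)"
  shows "(\<integral>\<^sup>+ x. ennreal (indicator unit_interval x *\<^sub>R (h x)\<^sup>2) \<partial>lborel) = ennreal ((l2norm h)\<^sup>2)"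
  unfolding l2norm_sq set_lebesgue_integral_def
  using assms unfolding set_integrable_def by (intro nn_integral_eq_integral) auto

lemma l2norm_leI:
  assumes m: "set_borel_measurable lborel unit_interval h"
    and le: "(\<integral>\<^sup>+ x. ennreal (indicator unit_interval x *\<^sub>R (h x)\<^sup>2) \<partial>lborel) \<le> ennreal (B\<^sup>2)" and "B \<ge> 0"
  shows "set_integrable lborel unit_interval (\<lambda>x. (h x)\<^sup>2)" "l2norm h \<le> B"
proof -
  show *: "set_integrable lborel unit_interval (\<lambda>x. (h x)\<^sup>2)"
    unfolding set_integrable_def
  proof (rule integrableI_bounded[OF square_measurable[OF m]])
    have "(\<integral>\<^sup>+ x. ennreal (norm (indicator unit_interval x *\<^sub>R (h x)\<^sup>2)) \<partial>lborel) \<le> ennreal (B\<^sup>2)"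
      using le by simp
    then show "(\<integral>\<^sup>+ x. ennreal (norm (indicator unit_interval x *\<^sub>R (h x)\<^sup>2)) \<partial>lborel) < \<infinity>"
      by (simp add: le_less_trans)
  qed
  have "(l2norm h)\<^sup>2 \<le> B\<^sup>2"
    using le unfolding nn_integral_square_unit[OF *] by simp
  then show "l2norm h \<le> B" using \<open>B \<ge> 0\<close> by (rule power2_le_imp_le)
qed

lemma l2norm_le_bound:
  assumes m: "set_borel_measurable lborel unit_interval h"
    and le: "\<And>x. 0 < x \<Longrightarrow> x < 1 \<Longrightarrow> \<bar>h x\<bar> \<le> B" and "B \<ge> 0"
  shows "set_integrable lborel unit_interval (\<lambda>x. (h x)\<^sup>2)" "l2norm h \<le> B"
proof -
  have "(\<integral>\<^sup>+ x. ennreal (indicator unit_interval x *\<^sub>R (h x)\<^sup>2) \<partial>lborel) \<le> (\<integral>\<^sup>+ x. ennreal (B\<^sup>2) * indicator unit_interval x \<partial>lborel)"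
  proof (rule nn_integral_mono)
    fix x :: real
    have "(h x)\<^sup>2 \<le> B\<^sup>2" if "0 < x" "x < 1"
      using power_mono[OF le[OF that], of 2] by simp
    then show "ennreal (indicator unit_interval x *\<^sub>R (h x)\<^sup>2) \<le> ennreal (B\<^sup>2) * indicator unit_interval x"
      by (auto simp: indicator_def intro!: ennreal_leI)
  qed
  also have "\<dots> = ennreal (B\<^sup>2)" by (subst nn_integral_cmult_indicator) auto
  finally show "set_integrable lborel unit_interval (\<lambda>x. (h x)\<^sup>2)" "l2norm h \<le> B"
    using l2norm_leI[OF m _ \<open>B \<ge> 0\<close>] by auto
qed

text \<open>
  Only an inequality survives in the limit, since the functions may concentrate at \<open>0\<close>.
\<close>

lemma l2norm_Fatou:
  assumes m: "\<And>n. set_borel_measurable lborel unit_interval (h n)" "set_borel_measurable lborel unit_interval k"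
    and int: "\<And>n. set_integrable lborel unit_interval (\<lambda>x. (h n x)\<^sup>2)"
    and lim: "\<And>x. 0 < x \<Longrightarrow> x < 1 \<Longrightarrow> (\<lambda>n. h n x) \<longlonglongrightarrow> k x"
    and le: "\<And>n. l2norm (h n) \<le> B n" "B \<longlonglongrightarrow> \<beta>"
  shows "set_integrable lborel unit_interval (\<lambda>x. (k x)\<^sup>2)" "l2norm k \<le> \<beta>"
proof -
  have B0: "B n \<ge> 0" for n using le(1)[of n] l2norm_nonneg[of "h n"] by linarith
  then have b0: "\<beta> \<ge> 0" using le(2) by (intro LIMSEQ_le_const) auto
  define u where "u n x = ennreal (indicator unit_interval x *\<^sub>R (h n x)\<^sup>2)" for n x
  have um: "u n \<in> borel_measurable lborel" for n
    unfolding u_def using square_measurable[OF m(1)] by (intro measurable_compose[OF _ measurable_ennreal])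
  have "(\<lambda>n. u n x) \<longlonglongrightarrow> ennreal (indicator unit_interval x *\<^sub>R (k x)\<^sup>2)" for x
    unfolding u_def by (cases "x \<in> unit_interval") (auto intro!: tendsto_ennrealI tendsto_power lim)
  then have "ennreal (indicator unit_interval x *\<^sub>R (k x)\<^sup>2) = liminf (\<lambda>n. u n x)" for x
    by (intro lim_imp_Liminf[symmetric]) auto
  then have "(\<integral>\<^sup>+ x. ennreal (indicator unit_interval x *\<^sub>R (k x)\<^sup>2) \<partial>lborel) = (\<integral>\<^sup>+ x. liminf (\<lambda>n. u n x) \<partial>lborel)"
    by simp
  also have "\<dots> \<le> liminf (\<lambda>n. \<integral>\<^sup>+ x. u n x \<partial>lborel)"
    by (rule nn_integral_liminf) (rule um)
  also have "\<dots> \<le> liminf (\<lambda>n. ennreal ((B n)\<^sup>2))"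
    unfolding u_def nn_integral_square_unit[OF int]
    by (intro Liminf_mono always_eventually allI ennreal_leI power_mono le l2norm_nonneg)
  also have "\<dots> = ennreal (\<beta>\<^sup>2)"
    by (intro lim_imp_Liminf tendsto_ennrealI tendsto_power le) auto
  finally show "set_integrable lborel unit_interval (\<lambda>x. (k x)\<^sup>2)" "l2norm k \<le> \<beta>"
    using l2norm_leI[OF m(2) _ b0] by auto
qed

lemma C2_D: "f \<in> C2 \<Longrightarrow> f \<in> CM" "f \<in> C2 \<Longrightarrow> set_integrable lborel unit_interval (\<lambda>x. (f x)\<^sup>2)"
  by (auto simp: C2_def)

text \<open>
  As \<open>f\<close> decreases, \<open>f\<^sup>2\<close> is at least \<open>(f x)\<^sup>2\<close> on all of \<open>(0,x)\<close>.
\<close>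

lemma C2_sqrt_bound:
  assumes f: "f \<in> C2" and x: "0 < x" "x \<le> 1"
  shows "f x * sqrt x \<le> l2norm f"
proof -
  note C = C2_D[OF f]
  have "ennreal ((f x)\<^sup>2 * x) = (\<integral>\<^sup>+ t. ennreal ((f x)\<^sup>2) * indicator {0<..<x} t \<partial>lborel)"
    using x by (subst nn_integral_cmult_indicator) (auto simp: ennreal_mult)
  also have "\<dots> \<le> (\<integral>\<^sup>+ t. ennreal (indicator unit_interval t *\<^sub>R (f t)\<^sup>2) \<partial>lborel)"
  proof (rule nn_integral_mono)
    fix t :: real
    have "(f x)\<^sup>2 \<le> (f t)\<^sup>2" if "0 < t" "t < x"
      using CM_antimono[OF C(1) that(1), of x] that CM_nonneg[OF C(1) x(1)] by (intro power_mono) auto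
    then show "ennreal ((f x)\<^sup>2) * indicator {0<..<x} t \<le> ennreal (indicator unit_interval t *\<^sub>R (f t)\<^sup>2)"
      using x by (auto simp: indicator_def intro!: ennreal_leI)
  qed
  also have "\<dots> = ennreal ((l2norm f)\<^sup>2)" by (rule nn_integral_square_unit[OF C(2)])
  finally have "(f x)\<^sup>2 * x \<le> (l2norm f)\<^sup>2" by simp
  then have "(f x * sqrt x)\<^sup>2 \<le> (l2norm f)\<^sup>2" using x by (simp add: power_mult_distrib)
  then show ?thesis by (rule power2_le_imp_le) (rule l2norm_nonneg)
qed

text \<open>
  The pointwise bound for functions of norm one in \<^const>\<open>C2\<close> (\<open>C2_le_envelope\<close>).
\<close>

definition envelope :: "real \<Rightarrow> real" where "envelope x = max 1 (1 / sqrt x)"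

lemma C2_le_envelope:
  assumes f: "f \<in> C2" and x: "0 < x"
  shows "f x \<le> l2norm f * envelope x"
proof (cases "x \<le> 1")
  case True
  then have "f x \<le> l2norm f * (1 / sqrt x)"
    using C2_sqrt_bound[OF f x True] x by (simp add: field_simps)
  also have "\<dots> \<le> l2norm f * envelope x"
    by (intro mult_left_mono l2norm_nonneg) (auto simp: envelope_def)
  finally show ?thesis .
next
  case False
  have "f x \<le> f 1" using CM_antimono[OF C2_D(1)[OF f], of 1 x] False by simp
  also have "\<dots> \<le> l2norm f * 1" using C2_sqrt_bound[OF f, of 1] by simp
  also have "\<dots> \<le> l2norm f * envelope x"
    by (intro mult_left_mono l2norm_nonneg) (auto simp: envelope_def)
  finally show ?thesis .
qed

lemma set_borel_measurable_unit_diff: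
  fixes f g :: "real \<Rightarrow> real"
  assumes "set_borel_measurable lborel unit_interval f" "set_borel_measurable lborel unit_interval g"
  shows "set_borel_measurable lborel unit_interval (\<lambda>x. f x - g x)"
  using assms unfolding set_borel_measurable_def scaleR_diff_right by (rule borel_measurable_diff)

lemma C2_diff_square_integrable:
  assumes f: "f \<in> C2" and g: "g \<in> C2"
  shows "set_integrable lborel unit_interval (\<lambda>x. (f x - g x)\<^sup>2)"
proof -
  have "set_integrable lborel unit_interval (\<lambda>x. 2 * (f x)\<^sup>2 + 2 * (g x)\<^sup>2)"
    using C2_D(2)[OF f] C2_D(2)[OF g] by (intro set_integral_add set_integrable_mult_right) auto
  then show ?thesis
    unfolding set_integrable_def
  proof (rule Bochner_Integration.integrable_bound)
    show "(\<lambda>x. indicator unit_interval x *\<^sub>R (f x - g x)\<^sup>2) \<in> borel_measurable lborel"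
      by (intro square_measurable set_borel_measurable_unit_diff CM_measurable C2_D f g)
    have "(f x - g x)\<^sup>2 \<le> 2 * (f x)\<^sup>2 + 2 * (g x)\<^sup>2" for x
      using zero_le_power2[of "f x + g x"] by (simp add: power2_eq_square algebra_simps)
    then show "AE x in lborel. norm (indicator unit_interval x *\<^sub>R (f x - g x)\<^sup>2) \<le> norm (indicator unit_interval x *\<^sub>R (2 * (f x)\<^sup>2 + 2 * (g x)\<^sup>2))"
      by (intro AE_I2) (auto simp: indicator_def)
  qed
qed

lemma C2_scale:
  assumes "f \<in> C2" "c \<ge> 0" shows "(\<lambda>x. c * f x) \<in> C2"
  using assms CM_scale[of f c] by (auto simp: C2_def power_mult_distrib)

lemma C2_integrable:
  assumes f: "f \<in> C2" shows "set_integrable lborel unit_interval f"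
proof -
  have "set_integrable lborel unit_interval (\<lambda>x. (f x)\<^sup>2 + 1)"
    using C2_D(2)[OF f] by (intro set_integral_add) (auto simp: set_integrable_def)
  then show ?thesis
    unfolding set_integrable_def
  proof (rule Bochner_Integration.integrable_bound)
    show "(\<lambda>x. indicator unit_interval x *\<^sub>R f x) \<in> borel_measurable lborel"
      using CM_measurable[OF C2_D(1)[OF f]] by (simp add: set_borel_measurable_def)
    have "\<bar>f x\<bar> \<le> (f x)\<^sup>2 + 1" for x
    proof -
      have "0 \<le> (\<bar>f x\<bar> - 1)\<^sup>2 + \<bar>f x\<bar>" by simp
      then show ?thesis by (simp add: power2_eq_square algebra_simps)
    qed
    then show "AE x in lborel. norm (indicator unit_interval x *\<^sub>R f x) \<le> norm (indicator unit_interval x *\<^sub>R ((f x)\<^sup>2 + 1))"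
      by (intro AE_I2) (auto simp: indicator_def)
  qed
qed

lemma C2_add_const:
  assumes f: "f \<in> C2" and c: "c \<ge> 0"
  shows "(\<lambda>x. f x + c) \<in> C2"
    "l2norm (\<lambda>x. f x + c) = sqrt ((l2norm f)\<^sup>2 + 2 * c * (LINT x:unit_interval|lborel. f x) + c\<^sup>2)"
proof -
  have eq: "(\<lambda>x. (f x + c)\<^sup>2) = (\<lambda>x. ((f x)\<^sup>2 + (2 * c) * f x) + c\<^sup>2)"
    by (auto simp: power2_eq_square algebra_simps)
  have 1: "set_integrable lborel unit_interval (\<lambda>x. (f x)\<^sup>2)" by (rule C2_D(2)[OF f])
  have 2: "set_integrable lborel unit_interval (\<lambda>x. (2 * c) * f x)"
    using C2_integrable[OF f] by (rule_tac set_integrable_mult_right)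
  have 3: "set_integrable lborel unit_interval (\<lambda>x. c\<^sup>2)"
    by (auto simp: set_integrable_def)
  show "(\<lambda>x. f x + c) \<in> C2"
    using CM_add[OF C2_D(1)[OF f] CM_const[OF c]] 1 2 3
    unfolding C2_def mem_Collect_eq eq by (intro conjI set_integral_add)
  have "(LINT x:unit_interval|lborel. (f x + c)\<^sup>2) = (l2norm f)\<^sup>2 + 2 * c * (LINT x:unit_interval|lborel. f x) + c\<^sup>2"
    unfolding eq l2norm_sq set_integral_add(2)[OF set_integral_add(1)[OF 1 2] 3] set_integral_add(2)[OF 1 2]
    by (simp add: set_lebesgue_integral_def)
  then show "l2norm (\<lambda>x. f x + c) = sqrt ((l2norm f)\<^sup>2 + 2 * c * (LINT x:unit_interval|lborel. f x) + c\<^sup>2)"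
    by (simp add: l2norm_def)
qed

section \<open>Existence of the maximum\<close>

text \<open>
  Pairs normalised so that the quotient in \<^const>\<open>Delta\<close> disappears. Asking for \<open>\<le> 1\<close> rather than \<open>= 1\<close>
  keeps the condition closed under pointwise limits; \<open>feasible_imp_Delta_value\<close> shows that
  this does not enlarge the set of values.
\<close>

definition feasible :: "real \<Rightarrow> (real \<Rightarrow> real) \<Rightarrow> (real \<Rightarrow> real) \<Rightarrow> bool" where
  "feasible \<epsilon> f g \<longleftrightarrow> f \<in> C2 \<and> g \<in> C2 \<and> l2norm f + l2norm g \<le> 1 \<and> l2norm (\<lambda>x. f x - g x) \<le> \<epsilon>"

text \<open>
  The predicate whose greatest element is \<^const>\<open>Delta_max\<close>.
\<close>

definition Delta_value :: "real \<Rightarrow> real \<Rightarrow> real \<Rightarrow> bool" where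
  "Delta_value x0 \<epsilon> d \<longleftrightarrow> (\<exists>f\<in>C2. \<exists>g\<in>C2. \<not> (\<forall>x>0. f x = 0 \<and> g x = 0) \<and>
     l2norm (Delta f g) \<le> \<epsilon> \<and> d = \<bar>Delta f g x0\<bar>)"

text \<open>
  A common constant \<open>c\<close> added to both functions preserves the difference and moves the sum of the norms
  continuously from at most \<open>1\<close> at \<open>c = 0\<close> to at least \<open>1\<close> at \<open>c = 1\<close>. Where it equals \<open>1\<close>, \<^const>\<open>Delta\<close> is
  the plain difference.
\<close>

lemma feasible_imp_Delta_value:
  assumes "feasible \<epsilon> f g"
  shows "Delta_value x0 \<epsilon> \<bar>f x0 - g x0\<bar>"
proof -
  have f: "f \<in> C2" and g: "g \<in> C2" and le: "l2norm f + l2norm g \<le> 1" "l2norm (\<lambda>x. f x - g x) \<le> \<epsilon>"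
    using assms by (auto simp: feasible_def)
  define \<phi> where "\<phi> c = l2norm (\<lambda>x. f x + c) + l2norm (\<lambda>x. g x + c)" for c
  define \<psi> where "\<psi> f c = sqrt ((l2norm f)\<^sup>2 + 2 * c * (LINT x:unit_interval|lborel. f x) + c\<^sup>2)" for f c
  have \<phi>: "\<phi> c = \<psi> f c + \<psi> g c" if "c \<ge> 0" for c
    using C2_add_const(2)[OF f that] C2_add_const(2)[OF g that] by (simp add: \<phi>_def \<psi>_def)
  have "continuous_on {0..1} (\<lambda>c. \<psi> f c + \<psi> g c)"
    unfolding \<psi>_def by (intro continuous_intros)
  then have cont: "continuous_on {0..1} \<phi>"
    by (rule continuous_on_eq) (simp add: \<phi>)
  have int_pos: "0 \<le> (LINT x:unit_interval|lborel. h x)" if "h \<in> C2" for h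
    using CM_nonneg[OF C2_D(1)[OF that]] unfolding set_lebesgue_integral_def
    by (intro integral_nonneg_AE AE_I2) (auto simp: indicator_def)
  have "1 \<le> \<psi> f 1"
    unfolding \<psi>_def using int_pos[OF f] by (intro real_le_rsqrt) auto
  moreover have "0 \<le> \<psi> g 1"
    unfolding \<psi>_def using int_pos[OF g] by (intro real_sqrt_ge_zero) auto
  ultimately have "1 \<le> \<phi> 1" by (simp add: \<phi>)
  moreover have "\<phi> 0 \<le> 1" using le by (simp add: \<phi>_def)
  ultimately obtain c where c: "0 \<le> c" "\<phi> c = 1"
    using IVT'[of \<phi> 0 1 1] cont by auto
  define F G where "F = (\<lambda>x. f x + c)" and "G = (\<lambda>x. g x + c)"
  have FG: "F \<in> C2" "G \<in> C2" and s: "l2norm F + l2norm G = 1"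
    using C2_add_const(1)[OF f c(1)] C2_add_const(1)[OF g c(1)] c(2) by (auto simp: F_def G_def \<phi>_def)
  have D: "Delta F G = (\<lambda>x. f x - g x)"
    unfolding Delta_def[abs_def] s by (simp add: F_def G_def)
  have "\<not> (\<forall>x>0. F x = 0 \<and> G x = 0)"
  proof
    assume "\<forall>x>0. F x = 0 \<and> G x = 0"
    then have "l2norm F = l2norm (\<lambda>x. 0)" "l2norm G = l2norm (\<lambda>x. 0)"
      by (auto intro!: l2norm_cong)
    then show False using s by (simp add: l2norm_def)
  qed
  then show ?thesis
    unfolding Delta_value_def using FG D le(2) by (intro bexI[of _ F] bexI[of _ G]) auto
qed

text \<open>
  \<^const>\<open>Delta\<close> is invariant under scaling both functions by the same positive factor. The sum of the norms
  is positive because a function in \<^const>\<open>C2\<close> of norm zero vanishes on \<open>(0,\<infinity>)\<close>.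
\<close>

lemma Delta_value_imp_feasible:
  assumes "Delta_value x0 \<epsilon> d"
  obtains f g where "feasible \<epsilon> f g" "d = \<bar>f x0 - g x0\<bar>"
proof -
  obtain F G where FG: "F \<in> C2" "G \<in> C2" and nz: "\<not> (\<forall>x>0. F x = 0 \<and> G x = 0)"
    and D: "l2norm (Delta F G) \<le> \<epsilon>" "d = \<bar>Delta F G x0\<bar>"
    using assms by (auto simp: Delta_value_def)
  define c where "c = l2norm F + l2norm G"
  have "c \<noteq> 0"
  proof
    assume "c = 0"
    then have "l2norm F = 0" "l2norm G = 0"
      using l2norm_nonneg[of F] l2norm_nonneg[of G] by (auto simp: c_def)
    then have "F x = 0 \<and> G x = 0" if "x > 0" for x
      using C2_le_envelope[OF FG(1) that] C2_le_envelope[OF FG(2) that]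
        CM_nonneg[OF C2_D(1)[OF FG(1)] that] CM_nonneg[OF C2_D(1)[OF FG(2)] that] by auto
    then show False using nz by blast
  qed
  then have c: "c > 0" using l2norm_nonneg[of F] l2norm_nonneg[of G] by (auto simp: c_def)
  define f g where "f = (\<lambda>x. 1 / c * F x)" and "g = (\<lambda>x. 1 / c * G x)"
  have diff: "Delta F G = (\<lambda>x. f x - g x)"
    using c by (auto simp: Delta_def f_def g_def c_def[symmetric] fun_eq_iff diff_divide_distrib)
  have "l2norm f + l2norm g = 1"
    unfolding f_def g_def l2norm_scale using c by (simp add: c_def add_divide_distrib[symmetric])
  moreover have "f \<in> C2" "g \<in> C2"
    unfolding f_def g_def using c FG by (intro C2_scale; simp)+
  ultimately have "feasible \<epsilon> f g" using D(1) by (simp add: feasible_def diff)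
  moreover have "d = \<bar>f x0 - g x0\<bar>" using D(2) diff by simp
  ultimately show ?thesis by (rule that)
qed

lemma feasible_le_envelope:
  assumes "feasible \<epsilon> f g" "x > 0"
  shows "f x + g x \<le> envelope x"
proof -
  have "f x + g x \<le> (l2norm f + l2norm g) * envelope x"
    using C2_le_envelope[of f x] C2_le_envelope[of g x] assms by (auto simp: feasible_def distrib_right intro: add_mono)
  also have "\<dots> \<le> 1 * envelope x"
    using assms by (intro mult_right_mono) (auto simp: feasible_def envelope_def)
  finally show ?thesis by simp
qed

text \<open>
  After both functions converge pointwise, a third subsequence makes the norms of \<open>f n\<close> converge to
  some \<open>\<alpha>\<close>. Fatou then bounds the norms of the limits by \<open>\<alpha>\<close> and \<open>1 - \<alpha>\<close> separately.
\<close>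

lemma feasible_seq_compact:
  assumes F: "\<And>n. feasible \<epsilon> (f n) (g n)"
  shows "\<exists>r F G. strict_mono (r :: nat \<Rightarrow> nat) \<and> feasible \<epsilon> F G \<and>
    (\<forall>x>0. (\<lambda>n. f (r n) x - g (r n) x) \<longlonglongrightarrow> F x - G x)"
proof -
  have C: "f n \<in> C2" "g n \<in> C2" "l2norm (f n) + l2norm (g n) \<le> 1" "l2norm (\<lambda>x. f n x - g n x) \<le> \<epsilon>" for n
    using F[of n] by (auto simp: feasible_def)
  have CM: "f n \<in> CM" "g n \<in> CM" for n using C by (auto simp: C2_def)
  have bd: "f n x \<le> envelope x" "g n x \<le> envelope x" if "x > 0" for n x
    using feasible_le_envelope[OF F that, of n] CM_nonneg[OF CM(1) that] CM_nonneg[OF CM(2) that, of n]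
    by (smt (verit))+
  have "\<exists>(r :: nat \<Rightarrow> nat) h. strict_mono r \<and> h \<in> CM \<and> (\<forall>x>0. (\<lambda>n. f (r n) x) \<longlonglongrightarrow> h x)"
    by (rule CM_compactness[OF CM(1) bd(1)])
  then obtain r1 :: "nat \<Rightarrow> nat" and F where r1: "strict_mono r1" "F \<in> CM" "\<And>x. x > 0 \<Longrightarrow> (\<lambda>n. f (r1 n) x) \<longlonglongrightarrow> F x" by blast
  have "\<exists>(r :: nat \<Rightarrow> nat) h. strict_mono r \<and> h \<in> CM \<and> (\<forall>x>0. (\<lambda>n. g (r1 (r n)) x) \<longlonglongrightarrow> h x)"
    by (rule CM_compactness[OF CM(2) bd(2)])
  then obtain r2 :: "nat \<Rightarrow> nat" and G where r2: "strict_mono r2" "G \<in> CM" "\<And>x. x > 0 \<Longrightarrow> (\<lambda>n. g (r1 (r2 n)) x) \<longlonglongrightarrow> G x" by blast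
  have le1: "l2norm (f n) \<le> 1" "l2norm (g n) \<le> 1" for n
    using C(3)[of n] l2norm_nonneg[of "f n"] l2norm_nonneg[of "g n"] by linarith+
  have "bounded (range (\<lambda>n. l2norm (f (r1 (r2 n)))))"
    using le1 l2norm_nonneg by (auto simp: bounded_iff intro!: exI[of _ 1])
  then obtain \<alpha> r3 where r3: "strict_mono (r3 :: nat \<Rightarrow> nat)" and \<alpha>: "((\<lambda>n. l2norm (f (r1 (r2 n)))) \<circ> r3) \<longlonglongrightarrow> \<alpha>"
    using bounded_imp_convergent_subsequence by blast
  define r where "r n = r1 (r2 (r3 n))" for n
  have sr: "strict_mono r" using r1(1) r2(1) r3 by (auto simp: strict_mono_def r_def)
  have r23: "strict_mono (\<lambda>n. r2 (r3 n))" using r2(1) r3 by (auto simp: strict_mono_def)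
  have Fl: "(\<lambda>n. f (r n) x) \<longlonglongrightarrow> F x" if "x > 0" for x
    using LIMSEQ_subseq_LIMSEQ[OF r1(3)[OF that] r23] by (simp add: r_def o_def)
  have Gl: "(\<lambda>n. g (r n) x) \<longlonglongrightarrow> G x" if "x > 0" for x
    using LIMSEQ_subseq_LIMSEQ[OF r2(3)[OF that] r3] by (simp add: r_def o_def)
  have lima: "(\<lambda>n. l2norm (f (r n))) \<longlonglongrightarrow> \<alpha>" using \<alpha> by (simp add: r_def o_def)
  note Fatou_f = l2norm_Fatou[where h = "\<lambda>n. f (r n)" and k = F, OF CM_measurable[OF CM(1)] CM_measurable[OF r1(2)] C2_D(2)[OF C(1)] Fl order_refl lima]
  have gb: "l2norm (g n) \<le> 1 - l2norm (f n)" for n using C(3)[of n] by linarith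
  have limb: "(\<lambda>n. 1 - l2norm (f (r n))) \<longlonglongrightarrow> 1 - \<alpha>" by (intro tendsto_intros lima)
  note Fatou_g = l2norm_Fatou[where h = "\<lambda>n. g (r n)" and k = G, OF CM_measurable[OF CM(2)] CM_measurable[OF r2(2)] C2_D(2)[OF C(2)] Gl gb limb]
  have FlGl: "(\<lambda>n. f (r n) x - g (r n) x) \<longlonglongrightarrow> F x - G x" if "x > 0" for x
    by (intro tendsto_diff Fl Gl that)
  note Fatou_fg = l2norm_Fatou(2)[where h = "\<lambda>n x. f (r n) x - g (r n) x" and k = "\<lambda>x. F x - G x",
      OF set_borel_measurable_unit_diff[OF CM_measurable[OF CM(1)] CM_measurable[OF CM(2)]]
         set_borel_measurable_unit_diff[OF CM_measurable[OF r1(2)] CM_measurable[OF r2(2)]]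
         C2_diff_square_integrable[OF C(1) C(2)] FlGl C(4) tendsto_const]
  have "feasible \<epsilon> F G"
    unfolding feasible_def C2_def using r1(2) r2(2) Fatou_f Fatou_g Fatou_fg by auto
  then show ?thesis using sr FlGl by blast
qed

lemma C2_const: "c \<ge> 0 \<Longrightarrow> (\<lambda>x. c) \<in> C2"
  using CM_const[of c] by (auto simp: C2_def set_integrable_def)

lemma Delta_max_attained:
  assumes x0: "x0 \<ge> 1" and \<epsilon>: "\<epsilon> > 0"
  shows "Delta_value x0 \<epsilon> (Delta_max x0 \<epsilon>)" "\<And>d. Delta_value x0 \<epsilon> d \<Longrightarrow> d \<le> Delta_max x0 \<epsilon>"
proof -
  define V where "V = {d. Delta_value x0 \<epsilon> d}"
  have "feasible \<epsilon> (\<lambda>x. 0) (\<lambda>x. 0)"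
    using \<epsilon> C2_const[of 0] by (simp add: feasible_def l2norm_def)
  then have ne: "V \<noteq> {}" using feasible_imp_Delta_value[of \<epsilon>] by (auto simp: V_def)
  have env: "envelope x0 = 1" using x0 by (simp add: envelope_def max_def)
  have bdd: "bdd_above V"
  proof (rule bdd_aboveI)
    fix d assume "d \<in> V"
    then obtain f g where fg: "feasible \<epsilon> f g" "d = \<bar>f x0 - g x0\<bar>"
      unfolding V_def using Delta_value_imp_feasible by blast
    then have "f \<in> CM" "g \<in> CM" by (auto simp: feasible_def C2_def)
    then have "0 \<le> f x0" "0 \<le> g x0" using x0 CM_nonneg[of f x0] CM_nonneg[of g x0] by auto
    then show "d \<le> 1" using feasible_le_envelope[OF fg(1), of x0] fg(2) env x0 by auto
  qed
  define m where "m = Sup V"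
  have "\<exists>d\<in>V. m - 1 / Suc n < d" for n
  proof -
    have "m - 1 / Suc n < Sup V" by (simp add: m_def)
    then show ?thesis using less_cSup_iff[OF ne bdd] by auto
  qed
  then obtain d where d: "\<And>n. d n \<in> V" "\<And>n. m - 1 / Suc n < d n" by metis
  have "\<exists>f g. feasible \<epsilon> f g \<and> d n = \<bar>f x0 - g x0\<bar>" for n
    using d(1)[of n] Delta_value_imp_feasible unfolding V_def by blast
  then obtain f g where fg: "\<And>n. feasible \<epsilon> (f n) (g n)" "\<And>n. d n = \<bar>f n x0 - g n x0\<bar>" by metis
  obtain r F G where r: "strict_mono (r :: nat \<Rightarrow> nat)" and FG: "feasible \<epsilon> F G"
    and lim: "\<And>x. x > 0 \<Longrightarrow> (\<lambda>n. f (r n) x - g (r n) x) \<longlonglongrightarrow> F x - G x"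
    using feasible_seq_compact[of \<epsilon> f g, OF fg(1)] by blast
  have dm: "d \<longlonglongrightarrow> m"
  proof (rule tendsto_sandwich)
    show "(\<lambda>n. m - 1 / Suc n) \<longlonglongrightarrow> m"
      using LIMSEQ_inverse_real_of_nat_add_minus[of m] by (simp add: inverse_eq_divide)
    show "(\<lambda>n. m) \<longlonglongrightarrow> m" by simp
    show "\<forall>\<^sub>F n in sequentially. d n \<le> m"
      unfolding m_def using d(1) by (intro always_eventually allI cSup_upper bdd)
  qed (use d(2) in \<open>auto intro!: always_eventually less_imp_le\<close>)
  have "(\<lambda>n. \<bar>f (r n) x0 - g (r n) x0\<bar>) \<longlonglongrightarrow> \<bar>F x0 - G x0\<bar>"
    using x0 by (intro tendsto_rabs lim) auto
  then have "(\<lambda>n. d (r n)) \<longlonglongrightarrow> \<bar>F x0 - G x0\<bar>" by (simp add: fg(2))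
  moreover have "(\<lambda>n. d (r n)) \<longlonglongrightarrow> m" using LIMSEQ_subseq_LIMSEQ[OF dm r] by (simp add: o_def)
  ultimately have m: "m = \<bar>F x0 - G x0\<bar>" using LIMSEQ_unique by blast
  have mV: "Delta_value x0 \<epsilon> m" unfolding m by (rule feasible_imp_Delta_value[OF FG])
  have up: "d \<le> m" if "Delta_value x0 \<epsilon> d" for d
    unfolding m_def using that by (intro cSup_upper bdd) (simp add: V_def)
  have "Delta_max x0 \<epsilon> = m"
    unfolding Delta_max_def Delta_value_def[symmetric] by (rule Greatest_equality) (rule mV, erule up)
  then show "Delta_value x0 \<epsilon> (Delta_max x0 \<epsilon>)" "\<And>d. Delta_value x0 \<epsilon> d \<Longrightarrow> d \<le> Delta_max x0 \<epsilon>"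
    using mV up by auto
qed

section \<open>The upper bound\<close>

text \<open>
  This is Cauchy-Schwarz on an interval of length at most \<open>1\<close>, obtained by integrating
  \<open>\<bar>h\<bar> \<le> \<epsilon>/2 + h\<^sup>2 / (2 \<epsilon>)\<close>.
\<close>

lemma integral_diff_le_l2norm:
  assumes f: "f \<in> C2" and g: "g \<in> C2" and le: "l2norm (\<lambda>x. f x - g x) \<le> \<epsilon>" and e: "\<epsilon> > 0"
    and ab: "0 < a" "a \<le> b" "b < 1"
  shows "integral {a..b} (\<lambda>x. \<bar>f x - g x\<bar>) \<le> \<epsilon>"
proof -
  have cont: "continuous_on {a..b} f" "continuous_on {a..b} g"
    using ab by (auto intro!: continuous_on_subset[OF CM_continuous_on] C2_D f g)
  have i2: "(\<lambda>x. (f x - g x)\<^sup>2) integrable_on {a..b}"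
    by (intro integrable_continuous_real continuous_intros cont)
  have "integral {a..b} (\<lambda>x. \<bar>f x - g x\<bar>) \<le> integral {a..b} (\<lambda>x. \<epsilon> / 2 + (f x - g x)\<^sup>2 * (1 / (2 * \<epsilon>)))"
  proof (rule integral_le)
    show "(\<lambda>x. \<bar>f x - g x\<bar>) integrable_on {a..b}"
      by (intro integrable_continuous_real continuous_intros cont)
    show "(\<lambda>x. \<epsilon> / 2 + (f x - g x)\<^sup>2 * (1 / (2 * \<epsilon>))) integrable_on {a..b}"
      by (intro integrable_continuous_real continuous_intros cont)
    show "\<bar>f x - g x\<bar> \<le> \<epsilon> / 2 + (f x - g x)\<^sup>2 * (1 / (2 * \<epsilon>))" for x
    proof -
      have "0 \<le> (\<epsilon> - \<bar>f x - g x\<bar>)\<^sup>2" by simp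
      then have "2 * \<epsilon> * \<bar>f x - g x\<bar> \<le> \<epsilon>\<^sup>2 + (f x - g x)\<^sup>2"
        by (simp add: power2_diff)
      then show ?thesis using e by (simp add: field_simps power2_eq_square)
    qed
  qed
  also have "\<dots> = integral {a..b} (\<lambda>x. \<epsilon> / 2) + integral {a..b} (\<lambda>x. (f x - g x)\<^sup>2) * (1 / (2 * \<epsilon>))"
    by (simp only: Henstock_Kurzweil_Integration.integral_add[OF integrable_const_ivl integrable_on_mult_left[OF i2]]
          Henstock_Kurzweil_Integration.integral_mult_left)
  finally have split: "integral {a..b} (\<lambda>x. \<bar>f x - g x\<bar>) \<le>
    integral {a..b} (\<lambda>x. \<epsilon> / 2) + integral {a..b} (\<lambda>x. (f x - g x)\<^sup>2) * (1 / (2 * \<epsilon>))" .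
  have "integral {a..b} (\<lambda>x. (f x - g x)\<^sup>2) \<le> \<epsilon>\<^sup>2"
  proof -
    note sq = C2_diff_square_integrable[OF f g]
    have s: "set_integrable lborel {a..b} (\<lambda>x. (f x - g x)\<^sup>2)"
      by (rule set_integrable_subset[OF sq]) (use ab in auto)
    have "integral {a..b} (\<lambda>x. (f x - g x)\<^sup>2) = (LINT x:{a..b}|lborel. (f x - g x)\<^sup>2)"
      by (rule set_borel_integral_eq_integral(2)[OF s, symmetric])
    also have "\<dots> \<le> (LINT x:unit_interval|lborel. (f x - g x)\<^sup>2)"
      unfolding set_lebesgue_integral_def
      by (rule Bochner_Integration.integral_mono) (use s sq ab in \<open>auto simp: set_integrable_def indicator_def\<close>)
    also have "\<dots> = (l2norm (\<lambda>x. f x - g x))\<^sup>2" by (simp add: l2norm_sq)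
    also have "\<dots> \<le> \<epsilon>\<^sup>2" by (intro power_mono le l2norm_nonneg)
    finally show ?thesis .
  qed
  then have "integral {a..b} (\<lambda>x. (f x - g x)\<^sup>2) * (1 / (2 * \<epsilon>)) \<le> \<epsilon>\<^sup>2 * (1 / (2 * \<epsilon>))"
    using e by (intro mult_right_mono) auto
  also have "\<dots> = \<epsilon> / 2" using e by (simp add: power2_eq_square)
  finally have "integral {a..b} (\<lambda>x. (f x - g x)\<^sup>2) * (1 / (2 * \<epsilon>)) \<le> \<epsilon> / 2" .
  moreover have "integral {a..b} (\<lambda>x. \<epsilon> / 2) \<le> \<epsilon> / 2"
  proof -
    have "(b - a) * \<epsilon> \<le> 1 * \<epsilon>" using ab e by (intro mult_right_mono) auto
    then show ?thesis using ab by simp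
  qed
  ultimately show ?thesis using split by linarith
qed

lemma envelope_antimono: "0 < x \<Longrightarrow> x \<le> y \<Longrightarrow> envelope y \<le> envelope x"
  unfolding envelope_def by (intro max.mono divide_left_mono) auto

text \<open>
  The primitive \<open>I\<close> of the shifted difference is at most \<open>\<epsilon>\<close> on the slit \<open>[0, 1 - 2 \<delta>]\<close> and grows at most
  linearly in the half-plane, where the difference is bounded by \<open>envelope \<delta>\<close>. Division by \<open>(1 + z)\<^sup>2\<close> makes it
  bounded and vanishing at infinity, as the two-constants theorem asks. Since harmonic measure is continuous
  at the shifted point \<open>x0 - \<delta>\<close>, which lies off the slit even for \<open>x0 = 1\<close>, Cauchy's estimate for the derivative
  of \<open>I\<close> on a small circle costs only \<open>\<eta>\<close> in the exponent.
\<close>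

lemma feasible_upper_bound:
  assumes x0: "x0 \<ge> 1" and \<delta>: "0 < \<delta>" "\<delta> \<le> 1 / 4" and \<eta>: "\<eta> > 0"
  shows "\<exists>C>0. \<forall>\<epsilon> f g. 0 < \<epsilon> \<longrightarrow> \<epsilon> < 1 \<longrightarrow> feasible \<epsilon> f g \<longrightarrow>
    \<bar>f x0 - g x0\<bar> \<le> C * \<epsilon> powr (2 / pi * arcsin ((1 - 2 * \<delta>) / (x0 - \<delta>)) - \<eta>)"
proof -
  define a where "a = 1 - 2 * \<delta>"
  define y0 where "y0 = x0 - \<delta>"
  have a: "a > 0" "a < y0" using \<delta> x0 by (auto simp: a_def y0_def)
  define u where "u z = 2 / pi * Re (Arcsin (of_real a / z))" for z
  define \<gamma> where "\<gamma> = 2 / pi * arcsin (a / y0)"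
  have uy: "u (of_real y0) = \<gamma>"
  proof -
    have "\<bar>a / y0\<bar> \<le> 1" using a by simp
    then show ?thesis unfolding u_def \<gamma>_def by (simp add: arcsin_eq_Re_Arcsin)
  qed
  have "isCont u (of_real y0)"
    unfolding u_def using a
    by (intro continuous_intros isCont_o2[OF _ isCont_Arcsin]) auto
  then obtain \<rho> where \<rho>: "\<rho> > 0" "\<And>z. dist z (of_real y0) < \<rho> \<Longrightarrow> dist (u z) \<gamma> < \<eta>"
    using \<eta> unfolding continuous_at_eps_delta uy by metis
  define R where "R = min \<rho> (y0 - a) / 2"
  have R: "R > 0" "R < \<rho>" "R < y0 - a" using \<rho> a by (auto simp: R_def)
  define B where "B = envelope \<delta>"
  have B: "B \<ge> 1" by (simp add: B_def envelope_def)
  define C where "C = (1 + y0 + R)\<^sup>2 * B / R"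
  have C: "C > 0" using B R a by (auto simp: C_def intro!: divide_pos_pos mult_pos_pos zero_less_power)
  have "\<bar>f x0 - g x0\<bar> \<le> C * \<epsilon> powr (\<gamma> - \<eta>)" if \<epsilon>: "0 < \<epsilon>" "\<epsilon> < 1" and fg: "feasible \<epsilon> f g" for \<epsilon> f g
  proof -
    have fC: "f \<in> C2" and gC: "g \<in> C2" and le: "l2norm (\<lambda>x. f x - g x) \<le> \<epsilon>"
      using fg by (auto simp: feasible_def)
    obtain Ff where Ff: "Ff holomorphic_on {z. Re z > 0}" "\<And>x. x > 0 \<Longrightarrow> Ff (of_real x) = of_real (f x)"
        "\<And>z. Re z > 0 \<Longrightarrow> cmod (Ff z) \<le> f (Re z)"
      by (rule CM_holomorphic_extension[OF C2_D(1)[OF fC]]) (rule that)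
    obtain Fg where Fg: "Fg holomorphic_on {z. Re z > 0}" "\<And>x. x > 0 \<Longrightarrow> Fg (of_real x) = of_real (g x)"
        "\<And>z. Re z > 0 \<Longrightarrow> cmod (Fg z) \<le> g (Re z)"
      by (rule CM_holomorphic_extension[OF C2_D(1)[OF gC]]) (rule that)
    define F where "F z = Ff z - Fg z" for z
    have F_hol: "F holomorphic_on {z. Re z > 0}"
      unfolding F_def by (intro holomorphic_on_diff Ff Fg)
    have F_real: "F (of_real x) = of_real (f x - g x)" if "x > 0" for x
      using Ff(2)[OF that] Fg(2)[OF that] by (simp add: F_def)
    have F_bd: "cmod (F z) \<le> B" if "Re z \<ge> \<delta>" for z
    proof -
      have z0: "Re z > 0" using that \<delta> by simp
      have "cmod (F z) \<le> f (Re z) + g (Re z)"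
        unfolding F_def using Ff(3)[OF z0] Fg(3)[OF z0] norm_triangle_ineq4[of "Ff z" "Fg z"] by linarith
      also have "\<dots> \<le> envelope (Re z)" by (rule feasible_le_envelope[OF fg z0])
      also have "\<dots> \<le> B" unfolding B_def using that \<delta> by (intro envelope_antimono) auto
      finally show ?thesis .
    qed
    obtain J where J: "\<And>z. z \<in> {z. Re z > 0} \<Longrightarrow> (J has_field_derivative F z) (at z within {z. Re z > 0})"
      by (rule holomorphic_convex_primitive'[OF convex_halfspace_Re_gt open_halfspace_Re_gt F_hol]) (rule that)
    have J': "(J has_field_derivative F z) (at z)" if "Re z > 0" for z
      using J[of z] that at_within_open[OF _ open_halfspace_Re_gt, of z 0] by simp
    define I where "I z = J (z + of_real \<delta>) - J (of_real \<delta>)" for z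
    have I': "(I has_field_derivative F (z + of_real \<delta>)) (at z)" if "Re z > - \<delta>" for z
    proof -
      have "(J has_field_derivative F (z + of_real \<delta>)) (at (z + of_real \<delta>))"
        using that by (intro J') simp
      then have "((\<lambda>z. J (z + of_real \<delta>)) has_field_derivative F (z + of_real \<delta>)) (at z)"
        by (simp add: DERIV_shift)
      then show ?thesis unfolding I_def by (auto intro!: derivative_eq_intros)
    qed
    have I_hol: "I holomorphic_on {z. Re z > - \<delta>}"
      using I' open_halfspace_Re_gt by (auto simp: holomorphic_on_open)
    have I_bd: "cmod (I z) \<le> B * cmod z" if "Re z \<ge> 0" for z
    proof -
      have "cmod (I z - I 0) \<le> B * cmod (z - 0)"
      proof (rule field_differentiable_bound[where S = "{z. Re z \<ge> 0}" and f' = "\<lambda>z. F (z + of_real \<delta>)"])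
        show "convex {z. Re z \<ge> 0}" by (rule convex_halfspace_Re_ge)
        show "(I has_field_derivative F (w + of_real \<delta>)) (at w within {z. 0 \<le> Re z})" if "w \<in> {z. 0 \<le> Re z}" for w
          by (rule has_field_derivative_at_within, rule I') (use that \<delta> in auto)
        show "cmod (F (w + of_real \<delta>)) \<le> B" if "w \<in> {z. 0 \<le> Re z}" for w
          using that by (intro F_bd) auto
      qed (use that in auto)
      then show ?thesis by (simp add: I_def)
    qed
    have I_slit: "cmod (I (of_real x)) \<le> \<epsilon>" if x: "0 \<le> x" "x \<le> a" for x
    proof -
      have xd: "\<delta> \<le> \<delta> + x" "\<delta> + x < 1" using x \<delta> by (auto simp: a_def)
      have "((\<lambda>t. F (of_real t)) has_integral (J (of_real (\<delta> + x)) - J (of_real \<delta>))) {\<delta>..\<delta> + x}"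
      proof (rule fundamental_theorem_of_calculus[OF xd(1)])
        fix t assume "t \<in> {\<delta>..\<delta> + x}"
        then have "t > 0" using \<delta> by simp
        then show "((\<lambda>t. J (of_real t)) has_vector_derivative F (of_real t)) (at t within {\<delta>..\<delta> + x})"
          using J'[of "of_real t"] by (intro has_vector_derivative_real_field) simp
      qed
      then have hi: "((\<lambda>t. F (of_real t)) has_integral I (of_real x)) {\<delta>..\<delta> + x}"
        by (simp add: I_def add.commute)
      have "cmod (I (of_real x)) = cmod (integral {\<delta>..\<delta> + x} (\<lambda>t. F (of_real t)))"
        using hi by (simp add: integral_unique)
      also have "\<dots> \<le> integral {\<delta>..\<delta> + x} (\<lambda>t. \<bar>f t - g t\<bar>)"
      proof (rule Henstock_Kurzweil_Integration.integral_norm_bound_integral)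
        show "(\<lambda>t. F (of_real t)) integrable_on {\<delta>..\<delta> + x}" using hi by blast
        have "continuous_on {\<delta>..\<delta> + x} f" "continuous_on {\<delta>..\<delta> + x} g"
          using \<delta> by (auto intro!: continuous_on_subset[OF CM_continuous_on] C2_D fC gC)
        then show "(\<lambda>t. \<bar>f t - g t\<bar>) integrable_on {\<delta>..\<delta> + x}"
          by (intro integrable_continuous_real continuous_intros)
        show "cmod (F (of_real t)) \<le> \<bar>f t - g t\<bar>" if "t \<in> {\<delta>..\<delta> + x}" for t
          using that \<delta> F_real[of t] by (simp flip: of_real_diff)
      qed
      also have "\<dots> \<le> \<epsilon>"
        by (rule integral_diff_le_l2norm[OF fC gC le \<epsilon>(1) \<delta>(1) xd])
      finally show ?thesis .
    qed
    define H where "H z = I z / (1 + z)\<^sup>2" for z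
    have one_z: "1 \<le> cmod (1 + z)" "cmod z \<le> cmod (1 + z)" if "Re z \<ge> 0" for z
    proof -
      show "1 \<le> cmod (1 + z)" using complex_Re_le_cmod[of "1 + z"] that by simp
      have "(cmod z)\<^sup>2 \<le> (cmod (1 + z))\<^sup>2"
        unfolding cmod_power2 using that by (simp add: power2_eq_square algebra_simps)
      then show "cmod z \<le> cmod (1 + z)" by (rule power2_le_imp_le) simp
    qed
    have H_bd: "cmod (H z) \<le> B / cmod (1 + z)" if "Re z \<ge> 0" for z
    proof -
      have "cmod (H z) \<le> B * cmod (1 + z) / (cmod (1 + z))\<^sup>2"
        unfolding H_def norm_divide norm_power
        using I_bd[OF that] one_z[OF that] B
        by (intro divide_right_mono order_trans[OF I_bd[OF that]] mult_left_mono) auto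
      also have "\<dots> = B / cmod (1 + z)" using one_z(1)[OF that] by (auto simp: power2_eq_square)
      finally show ?thesis .
    qed
    have H_small: "cmod (H z) \<le> B * \<epsilon> powr u z" if z: "Re z > 0" "z \<notin> of_real ` {0..a}" for z
      unfolding u_def
    proof (rule two_constants_slit[OF a(1) \<epsilon> _ _ _ _ _ z])
      have nz: "1 + z \<noteq> 0" if "Re z \<ge> 0" for z using one_z(1)[OF that] by auto
      have "I holomorphic_on {z. Re z \<ge> 0}"
        by (rule holomorphic_on_subset[OF I_hol]) (use \<delta> in auto)
      then have hH: "H holomorphic_on {z. Re z \<ge> 0}"
        unfolding H_def by (intro holomorphic_intros) (use nz in auto)
      then show "continuous_on {z. 0 \<le> Re z} H" by (rule holomorphic_on_imp_continuous_on)
      show "H holomorphic_on {z. 0 < Re z}" by (rule holomorphic_on_subset[OF hH]) auto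
      show "cmod (H z) \<le> B" if "0 \<le> Re z" for z
      proof -
        have "B / cmod (1 + z) \<le> B / 1" using one_z(1)[OF that] B by (intro divide_left_mono) auto
        then show ?thesis using H_bd[OF that] by simp
      qed
      show "cmod (H (of_real x)) \<le> B * \<epsilon>" if "0 \<le> x" "x \<le> a" for x
      proof -
        have 1: "1 \<le> (cmod (1 + of_real x))\<^sup>2"
          using one_z(1)[of "of_real x"] that by (intro one_le_power) auto
        have "cmod (H (of_real x)) \<le> \<epsilon> / (cmod (1 + of_real x))\<^sup>2"
          unfolding H_def norm_divide norm_power by (intro divide_right_mono I_slit that) auto
        also have "\<dots> \<le> \<epsilon> / 1" using 1 \<epsilon> by (intro divide_left_mono) auto
        also have "\<dots> \<le> B * \<epsilon>" using B \<epsilon> by simp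
        finally show ?thesis .
      qed
      show "(H \<longlongrightarrow> 0) (inf at_infinity (principal {z. 0 \<le> Re z}))"
      proof (rule Lim_null_comparison)
        show "\<forall>\<^sub>F z in inf at_infinity (principal {z. 0 \<le> Re z}). cmod (H z) \<le> B / cmod z"
          unfolding eventually_inf_principal eventually_at_infinity
        proof (intro exI[of _ 1] allI impI)
          fix z :: complex assume z: "1 \<le> cmod z" "z \<in> {z. 0 \<le> Re z}"
          then have "0 < cmod z" "0 < cmod (1 + z)" using one_z(1)[of z] by auto
          then have "B / cmod (1 + z) \<le> B / cmod z"
            using one_z(2)[of z] B z by (intro divide_left_mono mult_pos_pos) auto
          then show "cmod (H z) \<le> B / cmod z" using H_bd[of z] z by simp
        qed
        have "((\<lambda>z::complex. B / cmod z) \<longlongrightarrow> 0) at_infinity"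
          by (intro real_tendsto_divide_at_top[OF tendsto_const] filterlim_norm_at_top)
        then show "((\<lambda>z::complex. B / cmod z) \<longlongrightarrow> 0) (inf at_infinity (principal {z. 0 \<le> Re z}))"
          by (rule tendsto_mono[rotated]) simp
      qed
    qed
    have I_small: "cmod (I z) \<le> (1 + y0 + R)\<^sup>2 * B * \<epsilon> powr (\<gamma> - \<eta>)" if z: "cmod (of_real y0 - z) = R" for z
    proof -
      have zy: "dist z (of_real y0) < \<rho>" using z R by (simp add: dist_norm norm_minus_commute)
      have "\<bar>Re (of_real y0 - z)\<bar> \<le> R" using abs_Re_le_cmod[of "of_real y0 - z"] z by simp
      then have Rz: "Re z > a" using R by auto
      have nz: "1 + z \<noteq> 0" using Rz a by (auto simp: complex_eq_iff)
      have "cmod (1 + z) \<le> cmod (1 + of_real y0) + cmod (z - of_real y0)"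
        using norm_triangle_ineq[of "1 + of_real y0" "z - of_real y0"] by (simp add: algebra_simps)
      also have "cmod (1 + of_real y0) = 1 + y0"
        using a by (metis abs_of_pos add_pos_pos less_trans norm_of_real of_real_1 of_real_add zero_less_one)
      finally have le1: "cmod (1 + z) \<le> 1 + y0 + R" using z by (simp add: norm_minus_commute)
      have "u z \<ge> \<gamma> - \<eta>" using \<rho>(2)[OF zy] by (simp add: dist_real_def)
      then have pw: "\<epsilon> powr u z \<le> \<epsilon> powr (\<gamma> - \<eta>)" using \<epsilon> by (intro powr_mono') auto
      have "cmod (I z) = (cmod (1 + z))\<^sup>2 * cmod (H z)"
        using nz by (simp add: H_def norm_divide norm_power)
      also have "\<dots> \<le> (1 + y0 + R)\<^sup>2 * (B * \<epsilon> powr (\<gamma> - \<eta>))"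
      proof (intro mult_mono power_mono le1)
        have "z \<notin> of_real ` {0..a}" using Rz by auto
        then have "cmod (H z) \<le> B * \<epsilon> powr u z" using Rz a by (intro H_small) auto
        also have "\<dots> \<le> B * \<epsilon> powr (\<gamma> - \<eta>)" using pw B by (intro mult_left_mono) auto
        finally show "cmod (H z) \<le> B * \<epsilon> powr (\<gamma> - \<eta>)" .
      qed auto
      finally show ?thesis by (simp add: mult.assoc)
    qed
    have sub: "cball (of_real y0) R \<subseteq> {z. Re z > - \<delta>}"
    proof
      fix z assume "z \<in> cball (complex_of_real y0) R"
      then have "\<bar>Re (of_real y0 - z)\<bar> \<le> R"
        using abs_Re_le_cmod[of "of_real y0 - z"] by (simp add: dist_norm)
      then show "z \<in> {z. Re z > - \<delta>}" using R a \<delta> by auto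
    qed
    have "cmod ((deriv ^^ 1) I (of_real y0)) \<le> fact 1 * ((1 + y0 + R)\<^sup>2 * B * \<epsilon> powr (\<gamma> - \<eta>)) / R ^ 1"
    proof (rule Cauchy_inequality[OF _ _ R(1) I_small])
      show "I holomorphic_on ball (of_real y0) R"
        by (rule holomorphic_on_subset[OF I_hol]) (use sub ball_subset_cball in blast)
      show "continuous_on (cball (of_real y0) R) I"
        by (rule continuous_on_subset[OF holomorphic_on_imp_continuous_on[OF I_hol] sub])
    qed
    moreover have "deriv I (of_real y0) = F (of_real y0 + of_real \<delta>)"
      using a \<delta> by (intro DERIV_imp_deriv I') auto
    moreover have "F (of_real y0 + of_real \<delta>) = of_real (f x0 - g x0)"
      using F_real[of x0] x0 by (simp add: y0_def flip: of_real_add)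
    ultimately show ?thesis by (simp add: C_def del: of_real_diff)
  qed
  then show ?thesis using C unfolding \<gamma>_def a_def y0_def by blast
qed

text \<open>
  The slit of \<open>feasible_upper_bound\<close> fills \<open>[0,1]\<close> as \<open>\<delta>\<close> tends to \<open>0\<close>, and its exponent is
  continuous in \<open>\<delta>\<close>.
\<close>

lemma Delta_max_upper:
  assumes x0: "x0 \<ge> 1" and \<eta>: "\<eta> > 0"
  shows "\<exists>C>0. \<forall>\<epsilon>. 0 < \<epsilon> \<longrightarrow> \<epsilon> < 1 \<longrightarrow>
    Delta_max x0 \<epsilon> \<le> C * \<epsilon> powr (2 / pi * arcsin (1 / x0) - \<eta>)"
proof -
  define h where "h \<delta> = 2 / pi * arcsin ((1 - 2 * \<delta>) / (x0 - \<delta>))" for \<delta>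
  have "continuous_on {0..1/4} h"
    unfolding h_def
  proof (intro continuous_intros ballI conjI)
    fix \<delta> :: real assume d: "\<delta> \<in> {0..1/4}"
    then show "x0 - \<delta> \<noteq> 0" using x0 by auto
    have "0 \<le> (1 - 2 * \<delta>) / (x0 - \<delta>)" using d x0 by (intro divide_nonneg_nonneg) auto
    then show "-1 \<le> (1 - 2 * \<delta>) / (x0 - \<delta>)" by simp
    show "(1 - 2 * \<delta>) / (x0 - \<delta>) \<le> 1" using d x0 by (auto simp: divide_le_eq)
  qed
  then have "\<exists>d>0. \<forall>\<delta>\<in>{0..1/4}. dist \<delta> 0 < d \<longrightarrow> dist (h \<delta>) (h 0) < \<eta> / 2"
    using \<eta> unfolding continuous_on_iff by (metis atLeastAtMost_iff half_gt_zero order_refl zero_le_divide_1_iff zero_le_numeral)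
  then obtain d where d: "d > 0" "\<And>\<delta>. 0 \<le> \<delta> \<Longrightarrow> \<delta> \<le> 1/4 \<Longrightarrow> \<delta> < d \<Longrightarrow> \<bar>h \<delta> - h 0\<bar> < \<eta> / 2"
    by (auto simp: dist_real_def)
  define \<delta> where "\<delta> = min (1/4) (d/2)"
  have \<delta>: "0 < \<delta>" "\<delta> \<le> 1/4" "\<delta> < d" using d(1) by (auto simp: \<delta>_def)
  have h: "h \<delta> \<ge> h 0 - \<eta> / 2" using d(2)[of \<delta>] \<delta> by (smt (verit))
  obtain C where C: "C > 0" "\<And>\<epsilon> f g. 0 < \<epsilon> \<Longrightarrow> \<epsilon> < 1 \<Longrightarrow> feasible \<epsilon> f g \<Longrightarrow>
      \<bar>f x0 - g x0\<bar> \<le> C * \<epsilon> powr (h \<delta> - \<eta> / 2)"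
    using feasible_upper_bound[OF x0 \<delta>(1,2), of "\<eta> / 2"] \<eta> unfolding h_def by auto
  have "Delta_max x0 \<epsilon> \<le> C * \<epsilon> powr (2 / pi * arcsin (1 / x0) - \<eta>)" if \<epsilon>: "0 < \<epsilon>" "\<epsilon> < 1" for \<epsilon>
  proof -
    obtain f g where fg: "feasible \<epsilon> f g" "Delta_max x0 \<epsilon> = \<bar>f x0 - g x0\<bar>"
      using Delta_value_imp_feasible[OF Delta_max_attained(1)[OF x0 \<epsilon>(1)]] by blast
    have "\<bar>f x0 - g x0\<bar> \<le> C * \<epsilon> powr (h \<delta> - \<eta> / 2)" by (rule C(2)[OF \<epsilon> fg(1)])
    also have "\<dots> \<le> C * \<epsilon> powr (h 0 - \<eta>)"
      using h C(1) \<epsilon> by (intro mult_left_mono powr_mono') auto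
    finally show ?thesis using fg(2) by (simp add: h_def)
  qed
  then show ?thesis using C(1) by blast
qed

section \<open>A Chebyshev function of imaginary degree\<close>

text \<open>
  For \<open>w = cos \<theta>\<close> this is \<open>cosh (k \<theta>)\<close>, the Chebyshev function of degree \<open>\<i> k\<close>. It oscillates between
  \<open>- 1\<close> and \<open>1\<close> for real \<open>w \<ge> 1\<close> and grows like \<open>exp (k \<theta>)\<close> where \<open>\<theta>\<close> is real.
\<close>

definition cheb :: "real \<Rightarrow> complex \<Rightarrow> complex" where
  "cheb k w = cosh (of_real k * Arccos w)"

text \<open>
  Choosing \<open>csqrt (w\<^sup>2 - 1)\<close> instead of \<open>csqrt (1 - w\<^sup>2)\<close> moves the branch cut away from \<open>w > 1\<close>. The two roots
  agree only up to a factor \<open>\<plusminus>\<i>\<close>; the sign turns \<open>w + s\<close> into \<open>w - s = 1 / (w + s)\<close>, its logarithm into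
  the negative, and is absorbed by the evenness of \<open>cosh\<close>.
\<close>

lemma cheb_eq_Ln:
  assumes "Re w > 0"
  shows "cheb k w = cosh (of_real k * (\<i> * Ln (w + csqrt (w\<^sup>2 - 1))))"
proof -
  define s where "s = csqrt (w\<^sup>2 - 1)"
  have s2: "s\<^sup>2 = w\<^sup>2 - 1" by (simp add: s_def)
  have "Re s \<ge> 0" unfolding s_def by (rule Re_csqrt)
  then have Re_pos: "Re (w + s) > 0" using assms by simp
  have prod: "(w + s) * (w - s) = 1"
    using s2 by (simp add: algebra_simps power2_eq_square)
  then have inv: "w - s = inverse (w + s)" by (simp add: inverse_unique)
  have "w + s \<notin> \<real>\<^sub>\<le>\<^sub>0" using Re_pos by (auto simp: complex_nonpos_Reals_iff)
  then have Ln: "Ln (w - s) = - Ln (w + s)" unfolding inv by (rule Ln_inverse)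
  have "(csqrt (1 - w\<^sup>2))\<^sup>2 = (\<i> * s)\<^sup>2" by (simp add: power_mult_distrib s2)
  then have "csqrt (1 - w\<^sup>2) = \<i> * s \<or> csqrt (1 - w\<^sup>2) = - (\<i> * s)"
    by (rule power2_eq_iff[THEN iffD1])
  then consider "Arccos w = - \<i> * Ln (w - s)" | "Arccos w = - \<i> * Ln (w + s)"
    unfolding Arccos_def by (force simp flip: mult.assoc)
  then show ?thesis
  proof cases
    case 1
    then show ?thesis unfolding cheb_def s_def[symmetric] Ln by simp
  next
    case 2
    then have "cheb k w = cosh (- (of_real k * (\<i> * Ln (w + s))))" by (simp add: cheb_def)
    then show ?thesis unfolding s_def[symmetric] by (simp only: cosh_minus)
  qed
qed

lemma holomorphic_cosh: "f holomorphic_on S \<Longrightarrow> (\<lambda>z. cosh (f z)) holomorphic_on S"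
  unfolding cosh_field_def by (intro holomorphic_intros) auto

text \<open>
  The defining formula is holomorphic off the real half-line \<open>w \<ge> 1\<close>, the formula of \<open>cheb_eq_Ln\<close> near every real
  \<open>w > 1\<close>. The remaining point \<open>w = 1\<close> is a removable singularity because the second formula is
  continuous there.
\<close>

lemma holomorphic_cheb: "cheb k holomorphic_on {w. Re w > -1}"
proof (rule no_isolated_singularity[where K = "{1}"])
  show op: "open {w::complex. Re w > -1}" by (rule open_halfspace_Re_gt)
  define A where "A = {w::complex. Re w > -1} - ({w. Im w = 0} \<inter> {w. 1 \<le> Re w})"
  define B where "B = {w::complex. Re w > 0} - (of_real ` {0..1})"
  have oA: "open A" unfolding A_def
    by (intro open_Diff op closed_Int closed_Collect_eq closed_Collect_le continuous_intros)
  have oB: "open B" unfolding B_def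
    by (intro open_Diff open_halfspace_Re_gt compact_imp_closed compact_continuous_image continuous_intros) auto
  have "Arccos holomorphic_on A"
    by (rule holomorphic_on_Arccos) (auto simp: A_def image_iff complex_eq_iff abs_less_iff not_le)
  then have hA: "cheb k holomorphic_on A"
    unfolding cheb_def by (intro holomorphic_cosh holomorphic_intros)
  have "(\<lambda>w. cosh (of_real k * (\<i> * Ln (w + csqrt (w\<^sup>2 - 1))))) holomorphic_on B"
  proof (intro holomorphic_cosh holomorphic_intros)
    fix w assume w: "w \<in> B"
    show "w\<^sup>2 - 1 \<notin> \<real>\<^sub>\<le>\<^sub>0"
    proof
      assume "w\<^sup>2 - 1 \<in> \<real>\<^sub>\<le>\<^sub>0"
      then have "2 * Re w * Im w = 0" and r: "(Re w)\<^sup>2 - (Im w)\<^sup>2 \<le> 1"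
        by (auto simp: complex_nonpos_Reals_iff Re_power2 Im_power2)
      then have im: "Im w = 0" using w by (auto simp: B_def)
      then have "(Re w)\<^sup>2 \<le> 1\<^sup>2" using r by simp
      then have "Re w \<le> 1" by (rule power2_le_imp_le) simp
      then have "w = of_real (Re w)" "Re w \<in> {0..1}" using im w by (auto simp: B_def complex_eq_iff)
      then show False using w by (auto simp: B_def)
    qed
    have "Re w > 0" using w by (simp add: B_def)
    then have "Re (w + csqrt (w\<^sup>2 - 1)) > 0"
      unfolding plus_complex.sel by (rule add_pos_nonneg) (rule Re_csqrt)
    then show "w + csqrt (w\<^sup>2 - 1) \<notin> \<real>\<^sub>\<le>\<^sub>0" by (auto simp: complex_nonpos_Reals_iff)
  qed
  then have hB: "cheb k holomorphic_on B"
    by (rule holomorphic_transform) (auto simp: B_def cheb_eq_Ln)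
  have AB: "{w. Re w > -1} - {1} = A \<union> B"
    by (auto simp: A_def B_def image_iff)
  show hol: "cheb k holomorphic_on ({w. Re w > -1} - {1})"
    unfolding AB by (rule holomorphic_on_Un[OF hA hB oA oB])
  have "isCont (cheb k) 1"
  proof -
    have "((\<lambda>w::complex. csqrt (w\<^sup>2 - 1)) \<longlongrightarrow> 0) (at 1)"
    proof (rule tendsto_norm_zero_cancel)
      have "((\<lambda>w::complex. sqrt (cmod (w\<^sup>2 - 1))) \<longlongrightarrow> sqrt (cmod (1\<^sup>2 - 1))) (at 1)"
        by (intro tendsto_intros)
      then show "((\<lambda>w::complex. cmod (csqrt (w\<^sup>2 - 1))) \<longlongrightarrow> 0) (at 1)" by simp
    qed
    then have "((\<lambda>w. w + csqrt (w\<^sup>2 - 1)) \<longlongrightarrow> 1 + 0) (at 1)" by (intro tendsto_intros)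
    then have "((\<lambda>w. Ln (w + csqrt (w\<^sup>2 - 1))) \<longlongrightarrow> Ln 1) (at 1)" by (intro tendsto_Ln) auto
    then have "((\<lambda>w. cosh (of_real k * (\<i> * Ln (w + csqrt (w\<^sup>2 - 1))))) \<longlongrightarrow> cosh (of_real k * (\<i> * Ln 1))) (at 1)"
      by (rule isCont_tendsto_compose[rotated]) (unfold cosh_field_def, intro continuous_intros, auto)
    moreover have "cheb k 1 = cosh (of_real k * (\<i> * Ln 1))" by (simp add: cheb_def)
    moreover have "\<forall>\<^sub>F w in at 1. cosh (of_real k * (\<i> * Ln (w + csqrt (w\<^sup>2 - 1)))) = cheb k w"
    proof -
      have "\<forall>\<^sub>F w::complex in at 1. w \<in> {w. 0 < Re w}"
        by (rule eventually_at_in_open'[OF open_halfspace_Re_gt]) simp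
      then show ?thesis by eventually_elim (simp add: cheb_eq_Ln)
    qed
    ultimately show ?thesis unfolding isCont_def by (auto intro: Lim_transform_eventually)
  qed
  then have "isCont (cheb k) w" if "w \<in> {w. Re w > -1}" for w
  proof (cases "w = 1")
    case False
    have "open ({w. Re w > -1} - {1::complex})" using op by (intro open_delete)
    then show ?thesis
      using holomorphic_on_imp_continuous_on[OF hol] that False continuous_on_interior
      by (auto simp: continuous_on_eq_continuous_at)
  qed auto
  then show "continuous_on {w. Re w > -1} (cheb k)"
    by (simp add: continuous_at_imp_continuous_on)
qed auto

lemma norm_cheb_le:
  assumes k: "k \<ge> 0" and w: "Re w \<ge> - a" "0 \<le> a" "a \<le> 1"
  shows "cmod (cheb k w) \<le> exp (k * (pi / 2 + arcsin a))"
proof -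
  define z where "z = of_real k * Arccos w"
  have Rez: "0 \<le> Re z" "Re z \<le> k * (pi / 2 + arcsin a)"
    using Re_Arccos_range(1)[of w] Re_Arccos_le[OF w] k by (auto simp: z_def intro: mult_left_mono)
  have "cmod (cosh z) \<le> (cmod (exp z) + cmod (exp (- z))) / 2"
    using norm_triangle_ineq[of "exp z" "exp (- z)"] by (simp add: cosh_field_def norm_divide)
  also have "\<dots> \<le> (exp (Re z) + exp (Re z)) / 2"
    using Rez by (intro divide_right_mono add_mono) auto
  also have "\<dots> \<le> exp (k * (pi / 2 + arcsin a))" using Rez by simp
  finally show ?thesis by (simp add: cheb_def z_def)
qed

lemma norm_cheb_ge_1_le:
  assumes "x \<ge> 1" shows "cmod (cheb k (of_real x)) \<le> 1"
proof -
  define l where "l = ln (x + sqrt (x\<^sup>2 - 1))"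
  have x2: "x\<^sup>2 - 1 \<ge> 0" using assms by simp
  have "csqrt ((of_real x)\<^sup>2 - 1) = of_real (sqrt (x\<^sup>2 - 1))"
    using x2 csqrt_of_real_nonneg[of "of_real (x\<^sup>2 - 1)"] by simp
  moreover have "x + sqrt (x\<^sup>2 - 1) > 0" using assms x2 by (intro add_pos_nonneg) auto
  ultimately have "Ln (of_real x + csqrt ((of_real x)\<^sup>2 - 1)) = of_real l"
    unfolding l_def by (simp add: Ln_of_real flip: of_real_add)
  then have "cheb k (of_real x) = cosh (\<i> * of_real (k * l))"
    using assms by (subst cheb_eq_Ln) (auto simp: mult_ac)
  also have "\<dots> = of_real (cos (k * l))"
    by (simp only: cosh_field_def cos_of_real[symmetric] cos_exp_eq)
  finally show ?thesis by simp
qed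

lemma cheb_le_1:
  assumes "0 < x" "x \<le> 1" shows "cheb k (of_real x) = of_real (cosh (k * arccos x))"
proof -
  have "Arccos (of_real x) = of_real (arccos x)" using assms by (simp add: of_real_arccos)
  then have "cheb k (of_real x) = cosh (of_real (k * arccos x))" by (simp add: cheb_def)
  also have "\<dots> = of_real (cosh (k * arccos x))"
    by (simp add: cosh_field_def flip: exp_of_real)
  finally show ?thesis .
qed

text \<open>
  If \<open>q = 1 / (\<xi> + \<beta>)\<close> then \<open>q / (1 - \<beta> q) = 1 / \<xi>\<close>. The Moebius map \<open>q \<mapsto> q / (1 - \<beta> q)\<close> sends the disc of
  radius \<open>1 / \<beta>\<close> to a half-plane that is only slightly larger than the right half-plane when \<open>\<beta>\<close> is
  large.
\<close>

lemma half_plane_of_disc: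
  fixes q :: complex
  assumes "\<beta> > 0" "cmod q < 1 / \<beta>"
  shows "1 - of_real \<beta> * q \<noteq> 0" "Re (q / (1 - of_real \<beta> * q)) > - (1 / (2 * \<beta>))"
proof -
  define p where "p = of_real \<beta> * q"
  have p: "cmod p < 1" using assms by (simp add: p_def norm_mult field_simps)
  then show nz: "1 - of_real \<beta> * q \<noteq> 0" by (auto simp: p_def[symmetric])
  have "1 - (cmod p)\<^sup>2 > 0" using p by (simp add: power_less_one_iff abs_square_less_1)
  then have "2 * Re (p * cnj (1 - p)) > - (cmod (1 - p))\<^sup>2"
    unfolding cmod_power2 by (simp add: power2_eq_square algebra_simps)
  moreover have n: "(cmod (1 - p))\<^sup>2 > 0" using nz by (simp add: p_def)
  ultimately have "2 * (Re (p * cnj (1 - p)) / (cmod (1 - p))\<^sup>2) > - 1"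
    by (simp add: field_simps)
  moreover have "p / (1 - p) = p * cnj (1 - p) / of_real ((cmod (1 - p))\<^sup>2)"
    by (rule complex_div_cnj)
  ultimately have "2 * Re (p / (1 - p)) > - 1" by (simp del: of_real_power)
  moreover have "q / (1 - p) = of_real (1 / \<beta>) * (p / (1 - p))"
    using assms by (simp add: p_def)
  then have "Re (q / (1 - p)) = Re (p / (1 - p)) / \<beta>" by (simp only: times_complex.sel Re_complex_of_real Im_complex_of_real) simp
  ultimately show "Re (q / (1 - of_real \<beta> * q)) > - (1 / (2 * \<beta>))"
    unfolding p_def[symmetric] using assms(1) by (simp add: field_simps)
qed

text \<open>
  The expansion is the Taylor series of \<open>cheb k (q / (1 - \<beta> q))\<close> at \<open>q = 0\<close>, and Cauchy's estimate bounds the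
  coefficients by the maximum of \<open>cheb k\<close> on the half-plane of \<open>half_plane_of_disc\<close>. Taking real
  parts of the coefficients is enough, since only real arguments matter.
\<close>

lemma cheb_expansion:
  assumes k: "k \<ge> 0" and \<beta>: "\<beta> \<ge> 1" and \<beta>': "\<beta>' > \<beta>"
  obtains a :: "nat \<Rightarrow> real" where
    "\<And>n. \<bar>a n\<bar> \<le> exp (k * (pi / 2 + arcsin (1 / (2 * \<beta>)))) * \<beta>' ^ n"
    "\<And>\<xi>. \<xi> > 0 \<Longrightarrow> (\<lambda>n. a n / (\<xi> + \<beta>) ^ n) sums Re (cheb k (of_real (1 / \<xi>)))"
proof -
  define P where "P q = cheb k (q / (1 - of_real \<beta> * q))" for q
  define S where "S = exp (k * (pi / 2 + arcsin (1 / (2 * \<beta>))))"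
  have b: "\<beta> > 0" "1 / (2 * \<beta>) \<le> 1" using \<beta> by auto
  note hp = half_plane_of_disc[OF b(1)]
  have P_hol: "P holomorphic_on ball 0 (1 / \<beta>)"
  proof -
    have "(\<lambda>q. q / (1 - of_real \<beta> * q)) holomorphic_on ball 0 (1 / \<beta>)"
      using hp(1) by (intro holomorphic_intros) auto
    moreover have "cheb k holomorphic_on (\<lambda>q. q / (1 - of_real \<beta> * q)) ` ball 0 (1 / \<beta>)"
    proof (rule holomorphic_on_subset[OF holomorphic_cheb], safe)
      fix q :: complex assume "q \<in> ball 0 (1 / \<beta>)"
      then show "Re (q / (1 - of_real \<beta> * q)) > -1" using hp(2)[of q] b(2) by simp
    qed
    ultimately show ?thesis
      using holomorphic_on_compose[of "\<lambda>q. q / (1 - of_real \<beta> * q)" _ "cheb k"] by (simp add: P_def[abs_def] o_def)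
  qed
  have P_bd: "cmod (P q) \<le> S" if "cmod q < 1 / \<beta>" for q
    unfolding P_def S_def using hp(2)[OF that] b by (intro norm_cheb_le k) auto
  define c where "c n = (deriv ^^ n) P 0 / fact n" for n
  define a where "a n = Re (c n)" for n
  show ?thesis
  proof
    fix n
    have r: "1 / \<beta>' > 0" "1 / \<beta>' < 1 / \<beta>" using b(1) \<beta>' by (auto intro: divide_strict_left_mono)
    have "cmod ((deriv ^^ n) P 0) \<le> fact n * S / (1 / \<beta>') ^ n"
    proof (rule Cauchy_inequality[OF _ _ r(1)])
      show "P holomorphic_on ball 0 (1 / \<beta>')"
        by (rule holomorphic_on_subset[OF P_hol]) (use r in auto)
      show "continuous_on (cball 0 (1 / \<beta>')) P"
        by (rule continuous_on_subset[OF holomorphic_on_imp_continuous_on[OF P_hol]]) (use r in auto)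
      show "cmod (P q) \<le> S" if "cmod (0 - q) = 1 / \<beta>'" for q
        using that r by (intro P_bd) simp
    qed
    then have "cmod (c n) \<le> S * \<beta>' ^ n"
      by (simp add: c_def norm_divide divide_le_eq power_divide mult_ac)
    then show "\<bar>a n\<bar> \<le> exp (k * (pi / 2 + arcsin (1 / (2 * \<beta>)))) * \<beta>' ^ n"
      using abs_Re_le_cmod[of "c n"] by (simp add: a_def S_def)
  next
    fix \<xi> :: real assume \<xi>: "\<xi> > 0"
    define q where "q = 1 / (\<xi> + \<beta>)"
    have q: "0 < q" "q < 1 / \<beta>" using \<xi> b by (auto simp: q_def intro: divide_strict_left_mono)
    have "(\<lambda>n. c n * (of_real q - 0) ^ n) sums P (of_real q)"
      unfolding c_def by (rule holomorphic_power_series[OF P_hol]) (use q in auto)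
    then have "(\<lambda>n. Re (c n * (of_real q - 0) ^ n)) sums Re (P (of_real q))" by (rule sums_Re)
    moreover have "Re (c n * (of_real q - 0) ^ n) = a n / (\<xi> + \<beta>) ^ n" for n
      by (simp add: a_def q_def power_divide flip: of_real_power)
    moreover have "of_real q / (1 - of_real \<beta> * of_real q) = complex_of_real (1 / \<xi>)"
    proof -
      have "q / (1 - \<beta> * q) = 1 / \<xi>" using \<xi> b by (simp add: q_def field_simps)
      then show ?thesis by (metis of_real_1 of_real_diff of_real_divide of_real_mult)
    qed
    ultimately show "(\<lambda>n. a n / (\<xi> + \<beta>) ^ n) sums Re (cheb k (of_real (1 / \<xi>)))"
      by (simp add: P_def)
  qed
qed

section \<open>Completely monotone functions from power expansions\<close>

lemma CM_cong: "f \<in> CM \<Longrightarrow> (\<And>x. x > 0 \<Longrightarrow> f x = g x) \<Longrightarrow> g \<in> CM"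
  by (auto simp: CM_def)

lemma CM_sum:
  assumes "\<And>i. i < (n::nat) \<Longrightarrow> f i \<in> CM" shows "(\<lambda>x. \<Sum>i<n. f i x) \<in> CM"
  using assms
proof (induction n)
  case 0
  then show ?case using CM_const[of 0] by simp
next
  case (Suc n)
  then show ?case using CM_add[of "\<lambda>x. \<Sum>i<n. f i x" "f n"] by simp
qed

text \<open>
  The partial sums increase to the sum, which bounds them; by \<open>CM_compactness\<close> some subsequence
  converges to a member of \<^const>\<open>CM\<close>, necessarily the sum.
\<close>

lemma CM_suminf:
  assumes f: "\<And>n. f n \<in> CM" and s: "\<And>x. x > 0 \<Longrightarrow> summable (\<lambda>n. f n x)"
  shows "(\<lambda>x. \<Sum>n. f n x) \<in> CM"
proof -
  have le: "(\<Sum>i<n. f i x) \<le> (\<Sum>i. f i x)" if "x > 0" for n x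
    by (rule sum_le_suminf[OF s[OF that]]) (auto simp: CM_nonneg[OF f that])
  have "\<exists>(r :: nat \<Rightarrow> nat) g. strict_mono r \<and> g \<in> CM \<and> (\<forall>x>0. (\<lambda>n. \<Sum>i<r n. f i x) \<longlonglongrightarrow> g x)"
    by (rule CM_compactness[where b = "\<lambda>x. \<Sum>i. f i x"]) (auto intro: CM_sum f le)
  then obtain r g where r: "strict_mono (r :: nat \<Rightarrow> nat)" and g: "g \<in> CM"
    and lim: "\<And>x. x > 0 \<Longrightarrow> (\<lambda>n. \<Sum>i<r n. f i x) \<longlonglongrightarrow> g x" by blast
  show ?thesis
  proof (rule CM_cong[OF g])
    fix x :: real assume x: "x > 0"
    have "(\<lambda>n. \<Sum>i<r n. f i x) \<longlonglongrightarrow> (\<Sum>i. f i x)"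
      using LIMSEQ_subseq_LIMSEQ[OF summable_LIMSEQ[OF s[OF x]] r] by (simp add: o_def)
    then show "g x = (\<Sum>n. f n x)" using lim[OF x] LIMSEQ_unique by blast
  qed
qed

text \<open>
  The terms with positive and with negative coefficients are summed separately. The shift by \<open>\<delta>\<close> keeps
  \<open>\<xi> x\<close> away from \<open>0\<close>, so both sums are dominated by one geometric series, uniformly in \<open>x > 0\<close>. Dividing by
  \<open>1 + \<delta>\<close> places \<open>\<xi> x\<close> in \<open>(0,1)\<close> for \<open>x < 1\<close>.
\<close>

lemma CM_difference_of_expansion:
  assumes \<delta>: "\<delta> > 0" and \<beta>': "0 \<le> \<beta>'" "\<beta>' < \<delta> / (1 + \<delta>) + \<beta>" "\<beta> > 0" and S: "S \<ge> 0"
    and a: "\<And>n. \<bar>a n\<bar> \<le> S * \<beta>' ^ n"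
  defines "\<xi> \<equiv> \<lambda>x. (x + \<delta>) / (1 + \<delta>)" and "C \<equiv> 1 / (1 - \<beta>' / (\<delta> / (1 + \<delta>) + \<beta>))"
  obtains f g where "f \<in> CM" "g \<in> CM"
    "\<And>x. x > 0 \<Longrightarrow> f x \<le> S * C" "\<And>x. x > 0 \<Longrightarrow> g x \<le> S * C"
    "\<And>x. x > 0 \<Longrightarrow> (\<lambda>n. a n / (\<xi> x + \<beta>) ^ n) sums (f x - g x)"
proof -
  define \<theta> where "\<theta> = \<beta>' / (\<delta> / (1 + \<delta>) + \<beta>)"
  have \<theta>: "0 \<le> \<theta>" "\<theta> < 1" using \<beta>' \<delta> by (auto simp: \<theta>_def)
  have \<xi>: "\<xi> x \<ge> \<delta> / (1 + \<delta>)" if "x > 0" for x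
    unfolding \<xi>_def using that \<delta> by (intro divide_right_mono) auto
  have basic: "(\<lambda>x. 1 / (\<xi> x + \<beta>) ^ n) \<in> CM" for n
  proof -
    have "(\<lambda>x. (1 + \<delta>) ^ n * (1 / (x + (\<delta> + \<beta> * (1 + \<delta>))) ^ n)) \<in> CM"
      using \<delta> \<beta>'(3) by (intro CM_scale CM_shifted_power) (auto intro: add_pos_pos)
    moreover have "(1 + \<delta>) ^ n * (1 / (x + (\<delta> + \<beta> * (1 + \<delta>))) ^ n) = 1 / (\<xi> x + \<beta>) ^ n" for x
    proof -
      have "\<xi> x + \<beta> = (x + (\<delta> + \<beta> * (1 + \<delta>))) / (1 + \<delta>)" using \<delta> by (simp add: \<xi>_def field_simps)
      then show ?thesis by (simp add: power_divide)
    qed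
    ultimately show ?thesis by simp
  qed
  have part: "(\<lambda>x. \<Sum>n. c n / (\<xi> x + \<beta>) ^ n) \<in> CM \<and>
      (\<forall>x>0. summable (\<lambda>n. c n / (\<xi> x + \<beta>) ^ n) \<and> (\<Sum>n. c n / (\<xi> x + \<beta>) ^ n) \<le> S * C)"
    if c: "\<And>n. 0 \<le> c n" "\<And>n. c n \<le> \<bar>a n\<bar>" for c
  proof -
    have term_le: "c n / (\<xi> x + \<beta>) ^ n \<le> S * \<theta> ^ n" if "x > 0" for n x
    proof -
      have base: "0 < \<delta> / (1 + \<delta>) + \<beta>" using \<delta> \<beta>'(3) by (intro add_pos_pos) auto
      have "c n / (\<xi> x + \<beta>) ^ n \<le> (S * \<beta>' ^ n) / (\<delta> / (1 + \<delta>) + \<beta>) ^ n"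
        using c[of n] a[of n] \<xi>[OF that] base \<beta>'(1) S
        by (intro frac_le power_mono) auto
      also have "\<dots> = S * \<theta> ^ n" by (simp add: \<theta>_def power_divide)
      finally show ?thesis .
    qed
    have pos: "0 \<le> c n / (\<xi> x + \<beta>) ^ n" if "x > 0" for n x
    proof -
      have "0 \<le> \<delta> / (1 + \<delta>)" using \<delta> by simp
      then have "0 \<le> \<xi> x + \<beta>" using \<xi>[OF that] \<beta>'(3) by linarith
      then show ?thesis using c(1)[of n] by (intro divide_nonneg_nonneg zero_le_power)
    qed
    have geo: "(\<lambda>n. S * \<theta> ^ n) sums (S * C)"
      unfolding C_def \<theta>_def[symmetric] using \<theta> by (intro sums_mult geometric_sums) auto
    have sm: "summable (\<lambda>n. c n / (\<xi> x + \<beta>) ^ n)" if "x > 0" for x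
      by (rule summable_comparison_test'[OF sums_summable[OF geo], of 0])
        (simp only: real_norm_def abs_of_nonneg[OF pos[OF that]] term_le[OF that])
    have "(\<Sum>n. c n / (\<xi> x + \<beta>) ^ n) \<le> S * C" if "x > 0" for x
      using suminf_le[OF term_le[OF that] sm[OF that] sums_summable[OF geo]] sums_unique[OF geo] by simp
    moreover have "(\<lambda>x. \<Sum>n. c n / (\<xi> x + \<beta>) ^ n) \<in> CM"
    proof (rule CM_suminf)
      show "(\<lambda>x. c n / (\<xi> x + \<beta>) ^ n) \<in> CM" for n
        using CM_scale[OF basic[of n] c(1)[of n]] by simp
    qed (rule sm)
    ultimately show ?thesis using sm by blast
  qed
  define f where "f x = (\<Sum>n. max 0 (a n) / (\<xi> x + \<beta>) ^ n)" for x
  define g where "g x = (\<Sum>n. max 0 (- a n) / (\<xi> x + \<beta>) ^ n)" for x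
  have pf: "f \<in> CM \<and> (\<forall>x>0. summable (\<lambda>n. max 0 (a n) / (\<xi> x + \<beta>) ^ n) \<and> f x \<le> S * C)"
    unfolding f_def by (rule part) auto
  have pg: "g \<in> CM \<and> (\<forall>x>0. summable (\<lambda>n. max 0 (- a n) / (\<xi> x + \<beta>) ^ n) \<and> g x \<le> S * C)"
    unfolding g_def by (rule part) auto
  show ?thesis
  proof
    fix x :: real assume x: "x > 0"
    have "(\<lambda>n. max 0 (a n) / (\<xi> x + \<beta>) ^ n - max 0 (- a n) / (\<xi> x + \<beta>) ^ n) sums (f x - g x)"
      unfolding f_def g_def using pf pg x by (intro sums_diff summable_sums) auto
    moreover have "max 0 (a n) / (\<xi> x + \<beta>) ^ n - max 0 (- a n) / (\<xi> x + \<beta>) ^ n = a n / (\<xi> x + \<beta>) ^ n" for n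
      by (simp add: max_def)
    ultimately show "(\<lambda>n. a n / (\<xi> x + \<beta>) ^ n) sums (f x - g x)" by simp
  qed (use pf pg in auto)
qed

section \<open>The lower bound\<close>

text \<open>
  Scaled by \<open>N\<close>, the two parts of \<open>cheb k (1 / \<xi> x)\<close> have norms at most \<open>1/2\<close>. Their sizes before scaling exceed
  \<open>exp L\<close> by the factor \<open>C exp (L \<omega>)\<close>, which stems from the half-plane being slightly too large; this is
  the loss \<open>\<omega>\<close> in the exponent. On the slit the scaled difference is at most \<open>N \<le> \<epsilon>\<close>, and at \<open>x0\<close> it is of
  order \<open>N cosh (k arccos w0)\<close> with \<open>k arccos w0 = L (1 - 2/\<pi> arcsin w0)\<close>.
\<close>

lemma feasible_lower_bound:
  assumes x0: "x0 \<ge> 1" and \<delta>: "0 < \<delta>" "\<delta> < 1" and \<beta>: "\<beta> \<ge> 1"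
  defines "\<omega> \<equiv> 2 / pi * arcsin (1 / (2 * \<beta>))" and "w0 \<equiv> (1 + \<delta>) / (x0 + \<delta>)"
  shows "\<exists>c>0. \<forall>\<epsilon>. 0 < \<epsilon> \<longrightarrow> \<epsilon> < 1 \<longrightarrow>
    (\<exists>f g. feasible \<epsilon> f g \<and> c * \<epsilon> powr (2 / pi * arcsin w0 + \<omega>) \<le> \<bar>f x0 - g x0\<bar>)"
proof -
  \<comment> \<open>Cauchy's estimate needs a circle inside the disc, hence \<open>\<beta>' > \<beta>\<close>; the geometric series needs
    \<open>\<beta>'\<close> below \<open>\<xi> x + \<beta>\<close>.\<close>
  define \<beta>' where "\<beta>' = \<beta> + \<delta> / 2"
  have d2: "\<delta> / 2 < \<delta> / (1 + \<delta>)" using \<delta> by (intro divide_strict_left_mono) auto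
  have \<beta>': "\<beta>' > \<beta>" "0 \<le> \<beta>'" "\<beta>' < \<delta> / (1 + \<delta>) + \<beta>" "\<beta> > 0"
    using \<delta> \<beta> d2 by (auto simp: \<beta>'_def)
  define C where "C = 1 / (1 - \<beta>' / (\<delta> / (1 + \<delta>) + \<beta>))"
  have C: "C \<ge> 1"
  proof -
    have "0 < \<delta> / (1 + \<delta>) + \<beta>" using \<beta>' by linarith
    then have "0 \<le> \<beta>' / (\<delta> / (1 + \<delta>) + \<beta>)" "\<beta>' / (\<delta> / (1 + \<delta>) + \<beta>) < 1" using \<beta>' by auto
    then show ?thesis by (simp add: C_def)
  qed
  define \<xi> where "\<xi> x = (x + \<delta>) / (1 + \<delta>)" for x
  have w0: "0 < w0" "w0 \<le> 1" using \<delta> x0 by (auto simp: w0_def)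
  have \<omega>: "\<omega> \<ge> 0"
  proof -
    have "arcsin 0 \<le> arcsin (1 / (2 * \<beta>))" using \<beta> by (intro arcsin_le_arcsin) auto
    then show ?thesis by (simp add: \<omega>_def)
  qed
  define \<gamma> where "\<gamma> = 2 / pi * arcsin w0"
  have \<gamma>: "\<gamma> \<ge> 0"
  proof -
    have "arcsin 0 \<le> arcsin w0" using w0 by (intro arcsin_le_arcsin) auto
    then show ?thesis by (simp add: \<gamma>_def)
  qed
  have "\<exists>f g. feasible \<epsilon> f g \<and> 1 / (4 * C) * \<epsilon> powr (\<gamma> + \<omega>) \<le> \<bar>f x0 - g x0\<bar>" if \<epsilon>: "0 < \<epsilon>" "\<epsilon> < 1" for \<epsilon>
  proof -
    \<comment> \<open>With this \<open>L\<close> the normalising factor \<open>exp (- L (1 + \<omega>)) / (2 C)\<close> becomes \<open>\<epsilon> / (2 C)\<close>.\<close>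
    define L where "L = - ln \<epsilon> / (1 + \<omega>)"
    have L: "L > 0" unfolding L_def using \<epsilon> \<omega> by (intro divide_pos_pos) auto
    define k where "k = 2 * L / pi"
    have k: "k \<ge> 0" "k * pi / 2 = L" using L by (auto simp: k_def)
    define S where "S = exp (k * (pi / 2 + arcsin (1 / (2 * \<beta>))))"
    have S: "S = exp L * exp (L * \<omega>)"
    proof -
      have "k * (pi / 2 + arcsin (1 / (2 * \<beta>))) = L + L * \<omega>"
        by (simp add: k_def \<omega>_def field_simps)
      then show ?thesis by (simp add: S_def exp_add)
    qed
    obtain a :: "nat \<Rightarrow> real" where a: "\<And>n. \<bar>a n\<bar> \<le> S * \<beta>' ^ n"
      and sums: "\<And>\<xi>. \<xi> > 0 \<Longrightarrow> (\<lambda>n. a n / (\<xi> + \<beta>) ^ n) sums Re (cheb k (of_real (1 / \<xi>)))"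
      by (rule cheb_expansion[OF k(1) \<beta> \<beta>'(1), folded S_def]) (rule that)
    obtain F G where FG: "F \<in> CM" "G \<in> CM"
      and F_le: "\<And>x. x > 0 \<Longrightarrow> F x \<le> S * C" and G_le: "\<And>x. x > 0 \<Longrightarrow> G x \<le> S * C"
      and F_G: "\<And>x. x > 0 \<Longrightarrow> (\<lambda>n. a n / (\<xi> x + \<beta>) ^ n) sums (F x - G x)"
    proof -
      have "S \<ge> 0" by (simp add: S_def)
      show ?thesis
        by (rule CM_difference_of_expansion[OF \<delta>(1) \<beta>'(2,3,4) \<open>S \<ge> 0\<close> a, folded \<xi>_def C_def]) (rule that)
    qed
    have diff: "F x - G x = Re (cheb k (of_real (1 / \<xi> x)))" if "x > 0" for x
    proof -
      have "\<xi> x > 0" using that \<delta> by (simp add: \<xi>_def)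
      from sums_unique2[OF F_G[OF that] sums[OF this]] show ?thesis .
    qed
    define N where "N = 1 / (2 * C * S)"
    have S0: "S > 0" by (simp add: S_def)
    have N: "N > 0" using C S0 by (simp add: N_def)
    define f g where "f = (\<lambda>x. N * F x)" and "g = (\<lambda>x. N * G x)"
    have half: "\<bar>f x\<bar> \<le> 1 / 2" "\<bar>g x\<bar> \<le> 1 / 2" if "x > 0" for x
    proof -
      have "N * (S * C) = 1 / 2" using C S0 by (simp add: N_def)
      moreover have "N * F x \<le> N * (S * C)" "N * G x \<le> N * (S * C)"
        using N F_le[OF that] G_le[OF that] by (intro mult_left_mono; simp)+
      moreover have "0 \<le> N * F x" "0 \<le> N * G x"
        using N CM_nonneg[OF FG(1) that] CM_nonneg[OF FG(2) that] by simp_all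
      ultimately show "\<bar>f x\<bar> \<le> 1 / 2" "\<bar>g x\<bar> \<le> 1 / 2"
        unfolding f_def g_def by linarith+
    qed
    have CM: "f \<in> CM" "g \<in> CM" using CM_scale FG N by (auto simp: f_def g_def)
    note nf = l2norm_le_bound[OF CM_measurable[OF CM(1)] half(1)] and ng = l2norm_le_bound[OF CM_measurable[OF CM(2)] half(2)]
    have eps: "exp (- L) * exp (- (L * \<omega>)) = \<epsilon>"
    proof -
      have "exp (- L) * exp (- (L * \<omega>)) = exp (- (L * (1 + \<omega>)))"
        by (simp add: algebra_simps flip: exp_add)
      also have "L * (1 + \<omega>) = - ln \<epsilon>" using \<omega> by (simp add: L_def)
      finally show ?thesis using \<epsilon> by simp
    qed
    have N_eq: "N = \<epsilon> / (2 * C)"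
      unfolding N_def S eps[symmetric] by (simp add: exp_minus field_simps)
    have small: "\<bar>f x - g x\<bar> \<le> \<epsilon>" if "0 < x" "x < 1" for x
    proof -
      have "1 / \<xi> x \<ge> 1" using that \<delta> by (simp add: \<xi>_def)
      then have "\<bar>F x - G x\<bar> \<le> 1"
        using diff[OF that(1)] norm_cheb_ge_1_le[of "1 / \<xi> x" k] abs_Re_le_cmod[of "cheb k (of_real (1 / \<xi> x))"] by linarith
      then have "N * \<bar>F x - G x\<bar> \<le> N * 1" using N by (intro mult_left_mono) auto
      moreover have "\<bar>f x - g x\<bar> = N * \<bar>F x - G x\<bar>" using N by (simp add: f_def g_def abs_mult flip: right_diff_distrib)
      moreover have "N \<le> \<epsilon>" unfolding N_eq using C \<epsilon> by (simp add: divide_le_eq)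
      ultimately show ?thesis by linarith
    qed
    have "feasible \<epsilon> f g"
      unfolding feasible_def C2_def
      using CM nf ng l2norm_le_bound(2)[OF set_borel_measurable_unit_diff[OF CM_measurable[OF CM(1)] CM_measurable[OF CM(2)]] small] \<epsilon>
      by auto
    moreover have "1 / (4 * C) * \<epsilon> powr (\<gamma> + \<omega>) \<le> \<bar>f x0 - g x0\<bar>"
    proof -
      have "1 / \<xi> x0 = w0" by (simp add: \<xi>_def w0_def)
      then have FGx: "F x0 - G x0 = cosh (k * arccos w0)"
        using diff[of x0] x0 cheb_le_1[OF w0, of k] by simp
      have "arccos w0 = pi / 2 - arcsin w0" using arccos_arcsin_eq[of w0] w0 by simp
      moreover have "k * (pi / 2 - arcsin w0) = L - L * \<gamma>"
        by (simp add: k_def \<gamma>_def field_simps)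
      ultimately have "k * arccos w0 = L - L * \<gamma>" by (simp only:)
      then have "cosh (k * arccos w0) \<ge> exp (L - L * \<gamma>) / 2"
        by (simp add: cosh_field_def)
      then have "N * (exp (L - L * \<gamma>) / 2) \<le> N * (F x0 - G x0)"
        unfolding FGx using N by (intro mult_left_mono) auto
      also have "\<dots> = f x0 - g x0" by (simp add: f_def g_def algebra_simps)
      also have "N * (exp (L - L * \<gamma>) / 2) = 1 / (4 * C) * exp (- (L * (\<gamma> + \<omega>)))"
        unfolding N_eq eps[symmetric] by (simp add: exp_minus exp_diff exp_add field_simps)
      also have "exp (- (L * (\<gamma> + \<omega>))) = \<epsilon> powr ((\<gamma> + \<omega>) / (1 + \<omega>))"
        using \<epsilon> by (simp add: powr_def L_def)
      finally have "1 / (4 * C) * \<epsilon> powr ((\<gamma> + \<omega>) / (1 + \<omega>)) \<le> \<bar>f x0 - g x0\<bar>" by linarith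
      moreover have "\<epsilon> powr (\<gamma> + \<omega>) \<le> \<epsilon> powr ((\<gamma> + \<omega>) / (1 + \<omega>))"
      proof (rule powr_mono')
        have "(\<gamma> + \<omega>) * 1 \<le> (\<gamma> + \<omega>) * (1 + \<omega>)" using \<gamma> \<omega> by (intro mult_left_mono) auto
        then show "(\<gamma> + \<omega>) / (1 + \<omega>) \<le> \<gamma> + \<omega>" using \<omega> by (simp add: divide_le_eq)
      qed (use \<epsilon> in auto)
      then have "1 / (4 * C) * \<epsilon> powr (\<gamma> + \<omega>) \<le> 1 / (4 * C) * \<epsilon> powr ((\<gamma> + \<omega>) / (1 + \<omega>))"
        using C by (intro mult_left_mono) auto
      ultimately show ?thesis by linarith
    qed
    ultimately show ?thesis by blast
  qed
  moreover have "1 / (4 * C) > 0" using C by simp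
  ultimately show ?thesis unfolding \<gamma>_def by blast
qed

text \<open>
  With \<open>\<beta> = 1 / \<delta>\<close> both losses of \<open>feasible_lower_bound\<close> vanish as \<open>\<delta>\<close> tends to \<open>0\<close>.
\<close>

lemma Delta_max_lower:
  assumes x0: "x0 \<ge> 1" and \<eta>: "\<eta> > 0"
  shows "\<exists>c>0. \<forall>\<epsilon>. 0 < \<epsilon> \<longrightarrow> \<epsilon> < 1 \<longrightarrow>
    c * \<epsilon> powr (2 / pi * arcsin (1 / x0) + \<eta>) \<le> Delta_max x0 \<epsilon>"
proof -
  define h where "h \<delta> = 2 / pi * arcsin ((1 + \<delta>) / (x0 + \<delta>)) + 2 / pi * arcsin (\<delta> / 2)" for \<delta>
  have "continuous_on {0..1} h"
    unfolding h_def
  proof (intro continuous_intros ballI conjI)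
    fix \<delta> :: real assume d: "\<delta> \<in> {0..1}"
    then show "x0 + \<delta> \<noteq> 0" "-1 \<le> \<delta> / 2" "\<delta> / 2 \<le> 1" using x0 by auto
    have "0 \<le> (1 + \<delta>) / (x0 + \<delta>)" using d x0 by (intro divide_nonneg_nonneg) auto
    then show "-1 \<le> (1 + \<delta>) / (x0 + \<delta>)" by simp
    show "(1 + \<delta>) / (x0 + \<delta>) \<le> 1" using d x0 by (auto simp: divide_le_eq)
  qed simp_all
  then have "\<exists>d>0. \<forall>\<delta>\<in>{0..1}. dist \<delta> 0 < d \<longrightarrow> dist (h \<delta>) (h 0) < \<eta>"
    using \<eta> unfolding continuous_on_iff by (metis atLeastAtMost_iff order_refl zero_le_one)
  then obtain d where d: "d > 0" "\<And>\<delta>. 0 \<le> \<delta> \<Longrightarrow> \<delta> \<le> 1 \<Longrightarrow> \<delta> < d \<Longrightarrow> \<bar>h \<delta> - h 0\<bar> < \<eta>"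
    by (auto simp: dist_real_def)
  define \<delta> where "\<delta> = min (1/2) (d/2)"
  have \<delta>: "0 < \<delta>" "\<delta> < 1" "\<delta> < d" using d(1) by (auto simp: \<delta>_def)
  have h: "h \<delta> \<le> h 0 + \<eta>" using d(2)[of \<delta>] \<delta> by (smt (verit))
  have h0: "h 0 = 2 / pi * arcsin (1 / x0)" by (simp add: h_def)
  have "1 / \<delta> \<ge> 1" using \<delta> by simp
  from feasible_lower_bound[OF x0 \<delta>(1,2) this]
  obtain c where c: "c > 0" "\<And>\<epsilon>. 0 < \<epsilon> \<Longrightarrow> \<epsilon> < 1 \<Longrightarrow>
      \<exists>f g. feasible \<epsilon> f g \<and> c * \<epsilon> powr h \<delta> \<le> \<bar>f x0 - g x0\<bar>"
    unfolding h_def by auto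
  have "c * \<epsilon> powr (2 / pi * arcsin (1 / x0) + \<eta>) \<le> Delta_max x0 \<epsilon>" if \<epsilon>: "0 < \<epsilon>" "\<epsilon> < 1" for \<epsilon>
  proof -
    obtain f g where fg: "feasible \<epsilon> f g" "c * \<epsilon> powr h \<delta> \<le> \<bar>f x0 - g x0\<bar>" using c(2)[OF \<epsilon>] by blast
    have "c * \<epsilon> powr (h 0 + \<eta>) \<le> c * \<epsilon> powr h \<delta>"
      using h c(1) \<epsilon> by (intro mult_left_mono powr_mono') auto
    also note fg(2)
    also have "\<bar>f x0 - g x0\<bar> \<le> Delta_max x0 \<epsilon>"
      by (rule Delta_max_attained(2)[OF x0 \<epsilon>(1) feasible_imp_Delta_value[OF fg(1)]])
    finally show ?thesis by (simp add: h0)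
  qed
  then show ?thesis using c(1) by blast
qed

section \<open>The exponent\<close>

lemma log_ratio_tendsto:
  fixes D :: "real \<Rightarrow> real"
  assumes up: "\<And>\<eta>. \<eta> > 0 \<Longrightarrow> \<exists>C>0. \<forall>\<epsilon>. 0 < \<epsilon> \<longrightarrow> \<epsilon> < 1 \<longrightarrow> D \<epsilon> \<le> C * \<epsilon> powr (\<gamma> - \<eta>)"
    and lo: "\<And>\<eta>. \<eta> > 0 \<Longrightarrow> \<exists>c>0. \<forall>\<epsilon>. 0 < \<epsilon> \<longrightarrow> \<epsilon> < 1 \<longrightarrow> c * \<epsilon> powr (\<gamma> + \<eta>) \<le> D \<epsilon>"
  shows "((\<lambda>\<epsilon>. ln (D \<epsilon>) / ln \<epsilon>) \<longlongrightarrow> \<gamma>) (at_right 0)"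
proof (rule tendstoI)
  fix e :: real assume e: "e > 0"
  then have e2: "e / 2 > 0" by simp
  obtain C where C: "C > 0" "\<And>\<epsilon>. 0 < \<epsilon> \<Longrightarrow> \<epsilon> < 1 \<Longrightarrow> D \<epsilon> \<le> C * \<epsilon> powr (\<gamma> - e / 2)" using up[OF e2] by blast
  obtain c where c: "c > 0" "\<And>\<epsilon>. 0 < \<epsilon> \<Longrightarrow> \<epsilon> < 1 \<Longrightarrow> c * \<epsilon> powr (\<gamma> + e / 2) \<le> D \<epsilon>" using lo[OF e2] by blast
  have lim: "((\<lambda>\<epsilon>. b / ln \<epsilon>) \<longlongrightarrow> 0) (at_right 0)" for b :: real
    by real_asymp
  have "\<forall>\<^sub>F \<epsilon> in at_right 0. \<bar>ln C / ln \<epsilon>\<bar> < e / 2" "\<forall>\<^sub>F \<epsilon> in at_right 0. \<bar>ln c / ln \<epsilon>\<bar> < e / 2"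
    using tendstoD[OF lim[of "ln C"] e2] tendstoD[OF lim[of "ln c"] e2] by (simp_all add: dist_real_def)
  moreover have "\<forall>\<^sub>F \<epsilon> in at_right 0. \<epsilon> \<in> {0<..<1::real}" by (rule eventually_at_right_real) simp
  ultimately show "\<forall>\<^sub>F \<epsilon> in at_right 0. dist (ln (D \<epsilon>) / ln \<epsilon>) \<gamma> < e"
  proof eventually_elim
    case (elim \<epsilon>)
    then have \<epsilon>: "0 < \<epsilon>" "\<epsilon> < 1" and l: "ln \<epsilon> < 0" by auto
    have cp: "0 < c * \<epsilon> powr (\<gamma> + e / 2)" using c(1) \<epsilon> by simp
    have D: "0 < D \<epsilon>" using c(2)[OF \<epsilon>] cp by linarith
    have "ln (c * \<epsilon> powr (\<gamma> + e / 2)) \<le> ln (D \<epsilon>)" using c(2)[OF \<epsilon>] cp by (intro ln_mono) auto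
    then have 1: "ln c + (\<gamma> + e / 2) * ln \<epsilon> \<le> ln (D \<epsilon>)" using c(1) \<epsilon> by (simp add: ln_mult ln_powr)
    have "ln (D \<epsilon>) \<le> ln (C * \<epsilon> powr (\<gamma> - e / 2))" using C(2)[OF \<epsilon>] D by (intro ln_mono) auto
    then have 2: "ln (D \<epsilon>) \<le> ln C + (\<gamma> - e / 2) * ln \<epsilon>" using C(1) \<epsilon> by (simp add: ln_mult ln_powr)
    have "ln (D \<epsilon>) / ln \<epsilon> \<le> (ln c + (\<gamma> + e / 2) * ln \<epsilon>) / ln \<epsilon>"
      using 1 l by (intro divide_right_mono_neg) auto
    also have "\<dots> = ln c / ln \<epsilon> + (\<gamma> + e / 2)" using l by (simp add: add_divide_distrib)
    finally have A: "ln (D \<epsilon>) / ln \<epsilon> < \<gamma> + e" using elim by linarith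
    have "(ln C + (\<gamma> - e / 2) * ln \<epsilon>) / ln \<epsilon> \<le> ln (D \<epsilon>) / ln \<epsilon>"
      using 2 l by (intro divide_right_mono_neg) auto
    moreover have "(ln C + (\<gamma> - e / 2) * ln \<epsilon>) / ln \<epsilon> = ln C / ln \<epsilon> + (\<gamma> - e / 2)"
      using l by (simp add: add_divide_distrib)
    ultimately have "ln (D \<epsilon>) / ln \<epsilon> > \<gamma> - e" using elim by linarith
    then show ?case using A by (simp add: dist_real_def abs_less_iff)
  qed
qed

theorem theorem2p1:
  fixes x0 :: real
  assumes "x0 \<ge> 1"
  shows "((\<lambda>\<epsilon>. ln (Delta_max x0 \<epsilon>) / ln \<epsilon>) \<longlongrightarrow> 2 / pi * arcsin (1 / x0)) (at_right 0)"
  by (rule log_ratio_tendsto[OF Delta_max_upper[OF assms] Delta_max_lower[OF assms]])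

end
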